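(* \textsc{Strong Triadic Closure} parameterized by $k$ admits a problem kernel with at most $4k$ vertices, which can be computed in $\mathcal{O}(n\cdot m)$ time, where $n$ and $m$ are the numbers of vertices and edges of the input graph.
   Context: All graphs are finite, undirected and simple. A labeling of $G=(V,E)$ is a partition $(S_L,W_L)$ of $E$ into strong and weak edges; it is an STC-labeling if there are no strong edges $\{u,v\},\{v,w\}\in S_L$ with $\{u,w\}\notin E$. \textsc{Strong Triadic Closure}: given $G=(V,E)$ and $k\in\mathbb{N}$, decide whether $G$ has an STC-labeling with $|W_L|\le k$. A problem kernel (with respect to parameter $k$) is a polynomial-time algorithm mapping an instance $(G,k)$ to an equivalent instance $(G',k')$ (i.e., $(G,k)$ is a yes-instance iff $(G',k')$ is) with $k'\le k$ and the size of $G'$ bounded by a function of $k$; here the bound is on the number of vertices of $G'$.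
   Formalization: The bound of 4k vertices is claimed for k ≥ 1 only (for k = 0 it fails: a path on three vertices is a no-instance, the empty graph a yes-instance; there the size is bounded by a constant), and O(n·m) is read as at most C(n·m+1) steps. *)

theory Defs
  imports Main
begin

section \<open>Strong Triadic Closure\<close>

definition simple_graph :: "'a set \<Rightarrow> 'a set set \<Rightarrow> bool" where
  "simple_graph V E \<longleftrightarrow> finite V \<and> E \<subseteq> {{u, v} |u v. u \<in> V \<and> v \<in> V \<and> u \<noteq> v}"

definition labeling :: "'a set set \<Rightarrow> 'a set set \<Rightarrow> 'a set set \<Rightarrow> bool" where
  "labeling E S W \<longleftrightarrow> S \<union> W = E \<and> S \<inter> W = {}"

text \<open>The condition \<open>u \<noteq> w\<close> says that \<open>{u, v}\<close> and \<open>{v, w}\<close> are two different edges.\<close>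

definition stc_labeling :: "'a set set \<Rightarrow> 'a set set \<Rightarrow> 'a set set \<Rightarrow> bool" where
  "stc_labeling E S W \<longleftrightarrow> labeling E S W \<and>
     \<not> (\<exists>u v w. u \<noteq> w \<and> {u, v} \<in> S \<and> {v, w} \<in> S \<and> {u, w} \<notin> E)"

definition strong_triadic_closure :: "'a set \<Rightarrow> 'a set set \<Rightarrow> nat \<Rightarrow> bool" where
  "strong_triadic_closure V E k \<longleftrightarrow>
     simple_graph V E \<and> (\<exists>S W. stc_labeling E S W \<and> card W \<le> k)"


section \<open>A unit-cost random access machine\<close>

text \<open>
  Algorithms are programs of a deeply embedded while language over natural numbers. A state
  consists of number variables and of arrays, both named by numerals that are fixed in the program
  text; only array indices are computed. A program mentions finitely many names, so this is a
  random access machine under the uniform cost criterion, up to constant factors. Arithmetic is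
  addition and (truncated) subtraction. There is no multiplication, which at unit cost would make
  the machine unrealistically strong.
\<close>

record state =
  vars :: "nat \<Rightarrow> nat"
  arrs :: "nat \<Rightarrow> nat \<Rightarrow> nat"

datatype aexp = Num nat | Var nat | Get nat aexp | Add aexp aexp | Sub aexp aexp

datatype bexp = Less aexp aexp | Equal aexp aexp | Neg bexp | Conj bexp bexp

datatype com =
    Skip
  | Assign nat aexp
  | Put nat aexp aexp
  | Seq com com
  | If bexp com com
  | While bexp com

primrec aval :: "aexp \<Rightarrow> state \<Rightarrow> nat" where
  "aval (Num c) s = c"
| "aval (Var x) s = vars s x"
| "aval (Get a i) s = arrs s a (aval i s)"
| "aval (Add p q) s = aval p s + aval q s"
| "aval (Sub p q) s = aval p s - aval q s"

primrec bval :: "bexp \<Rightarrow> state \<Rightarrow> bool" where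
  "bval (Less p q) s \<longleftrightarrow> aval p s < aval q s"
| "bval (Equal p q) s \<longleftrightarrow> aval p s = aval q s"
| "bval (Neg b) s \<longleftrightarrow> \<not> bval b s"
| "bval (Conj b b') s \<longleftrightarrow> bval b s \<and> bval b' s"

primrec acost :: "aexp \<Rightarrow> nat" where
  "acost (Num c) = 1"
| "acost (Var x) = 1"
| "acost (Get a i) = acost i + 1"
| "acost (Add p q) = acost p + acost q + 1"
| "acost (Sub p q) = acost p + acost q + 1"

primrec bcost :: "bexp \<Rightarrow> nat" where
  "bcost (Less p q) = acost p + acost q + 1"
| "bcost (Equal p q) = acost p + acost q + 1"
| "bcost (Neg b) = bcost b + 1"
| "bcost (Conj b b') = bcost b + bcost b' + 1"

text \<open>\<open>exec c s t s'\<close>: started in \<open>s\<close>, the program \<open>c\<close> halts in \<open>s'\<close> after \<open>t\<close> elementary steps.\<close>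

inductive exec :: "com \<Rightarrow> state \<Rightarrow> nat \<Rightarrow> state \<Rightarrow> bool" where
  Skip: "exec Skip s 1 s"
| Assign: "exec (Assign x p) s (acost p + 1) (s\<lparr>vars := (vars s)(x := aval p s)\<rparr>)"
| Put: "exec (Put a i p) s (acost i + acost p + 1)
     (s\<lparr>arrs := (arrs s)(a := (arrs s a)(aval i s := aval p s))\<rparr>)"
| Seq: "exec c s t s' \<Longrightarrow> exec d s' t' s'' \<Longrightarrow> exec (Seq c d) s (t + t') s''"
| IfTrue: "bval b s \<Longrightarrow> exec c s t s' \<Longrightarrow> exec (If b c d) s (bcost b + t + 1) s'"
| IfFalse: "\<not> bval b s \<Longrightarrow> exec d s t s' \<Longrightarrow> exec (If b c d) s (bcost b + t + 1) s'"
| WhileFalse: "\<not> bval b s \<Longrightarrow> exec (While b c) s (bcost b + 1) s"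
| WhileTrue: "bval b s \<Longrightarrow> exec c s t s' \<Longrightarrow> exec (While b c) s' t' s'' \<Longrightarrow>
     exec (While b c) s (bcost b + t + t' + 1) s''"

inductive_cases SkipE: "exec Skip s t s'"
inductive_cases AssignE: "exec (Assign x p) s t s'"
inductive_cases PutE: "exec (Put a i p) s t s'"
inductive_cases SeqE: "exec (Seq c d) s t s'"
inductive_cases IfE: "exec (If b c d) s t s'"
inductive_cases WhileE: "exec (While b c) s t s'"

lemma exec_deterministic:
  "exec c s t s' \<Longrightarrow> exec c s u r \<Longrightarrow> u = t \<and> r = s'"
proof (induction arbitrary: u r rule: exec.induct)
  case (Skip s)
  then show ?case by (rule SkipE) simp
next
  case (Assign x p s)
  then show ?case by (rule AssignE) simp
next
  case (Put a i p s)
  then show ?case by (rule PutE) simp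
next
  case (Seq c s t s' d t' s'')
  from Seq.prems obtain v q v' where
    "exec c s v q" "exec d q v' r" "u = v + v'" by (rule SeqE)
  with Seq.IH show ?case by metis
next
  case (IfTrue b s c t s' d)
  from IfTrue.prems IfTrue.hyps(1) obtain v where
    "exec c s v r" "u = bcost b + v + 1" by (elim IfE) simp_all
  with IfTrue.IH show ?case by metis
next
  case (IfFalse b s d t s' c)
  from IfFalse.prems IfFalse.hyps(1) obtain v where
    "exec d s v r" "u = bcost b + v + 1" by (elim IfE) simp_all
  with IfFalse.IH show ?case by metis
next
  case (WhileFalse b s c)
  from WhileFalse.prems show ?case
    by (rule WhileE) (simp_all add: WhileFalse.hyps)
next
  case (WhileTrue b s c t s' t' s'')
  from WhileTrue.prems obtain v q v' where
    "exec c s v q" "exec (While b c) q v' r" "u = bcost b + v + v' + 1"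
    by (rule WhileE) (simp_all add: WhileTrue.hyps(1))
  with WhileTrue.IH show ?case by metis
qed


section \<open>Kernelization\<close>

text \<open>
  An instance with vertices \<open>0, \<dots>, n - 1\<close> is stored as a list of its edges, each occurring exactly
  once, in an arbitrary order and orientation: arrays 0 and 1 hold the two endpoints, and variables
  0, 1 and 2 hold the numbers of vertices and edges and the parameter.
\<close>

definition represents :: "state \<Rightarrow> nat \<Rightarrow> nat set set \<Rightarrow> nat \<Rightarrow> bool" where
  "represents s n E k \<longleftrightarrow> simple_graph {..<n} E \<and>
     vars s 0 = n \<and> vars s 1 = card E \<and> vars s 2 = k \<and>
     bij_betw (\<lambda>i. {arrs s 0 i, arrs s 1 i}) {..<card E} E"

definition input_state :: "state \<Rightarrow> nat \<Rightarrow> nat set set \<Rightarrow> nat \<Rightarrow> bool" where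
  "input_state s n E k \<longleftrightarrow> represents s n E k \<and>
     (\<forall>x>2. vars s x = 0) \<and> (\<forall>a i. a > 1 \<or> i \<ge> card E \<longrightarrow> arrs s a i = 0)"

definition runs_in_time :: "com \<Rightarrow> (nat \<Rightarrow> nat \<Rightarrow> nat) \<Rightarrow> bool" where
  "runs_in_time c T \<longleftrightarrow> (\<forall>s n E k. input_state s n E k \<longrightarrow>
     (\<exists>t s'. exec c s t s' \<and> t \<le> T n (card E)))"

definition stc_problem_kernel :: "com \<Rightarrow> (nat \<Rightarrow> nat) \<Rightarrow> bool" where
  "stc_problem_kernel c g \<longleftrightarrow>
     (\<exists>a d. runs_in_time c (\<lambda>n m. a * (n + m + 1) ^ d)) \<and>
     (\<forall>s n E k. input_state s n E k \<longrightarrow>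
       (\<exists>t s' n' E' k'. exec c s t s' \<and> represents s' n' E' k' \<and>
          (strong_triadic_closure {..<n} E k \<longleftrightarrow> strong_triadic_closure {..<n'} E' k') \<and>
          k' \<le> k \<and> n' \<le> g k))"

text \<open>
  The bound \<open>4 * k\<close> can only be meant for \<open>k \<ge> 1\<close>: for \<open>k = 0\<close> it admits just the graph without
  vertices, which is a yes-instance, whereas a path on three vertices is a no-instance. For \<open>k = 0\<close>
  the kernel size is still bounded, by \<open>g 0\<close>.
\<close>

lemma no_vertices_imp_yes:
  assumes "simple_graph {} E"
  shows "strong_triadic_closure {} E k"
proof -
  have "E = {}" using assms by (auto simp: simple_graph_def)
  then have "stc_labeling E {} {}" by (simp add: stc_labeling_def labeling_def)
  then have "\<exists>S W. stc_labeling E S W \<and> card W \<le> k" by fastforce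
  with assms show ?thesis unfolding strong_triadic_closure_def by blast
qed

lemma path_imp_no:
  "\<not> strong_triadic_closure {0::nat, 1, 2} {{0, 1}, {1, 2}} 0"
proof
  let ?E = "{{0::nat, 1}, {1, 2}}"
  assume "strong_triadic_closure {0::nat, 1, 2} ?E 0"
  then obtain S W where l: "stc_labeling ?E S W" and c: "card W \<le> 0"
    unfolding strong_triadic_closure_def by blast
  have e: "S \<union> W = ?E" using l by (simp add: stc_labeling_def labeling_def)
  then have "finite W" by (metis finite.emptyI finite.insertI finite_Un)
  with c e have "S = ?E" by simp
  then have "{0, 1} \<in> S" "{1, 2} \<in> S" by simp_all
  moreover have "{0::nat, 2} \<notin> ?E" "(0::nat) \<noteq> 2" by (simp_all add: doubleton_eq_iff)
  moreover have "\<not> (u \<noteq> w \<and> {u, v} \<in> S \<and> {v, w} \<in> S \<and> {u, w} \<notin> ?E)" for u v w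
    using l unfolding stc_labeling_def by metis
  ultimately show False by metis
qed

end

theory Submission
  imports Defs
begin

text \<open>
  Call a vertex \<open>v\<close> removable if its closed neighbourhood \<open>X\<close> is a clique and fewer edges leave \<open>X\<close>
  than there are vertices in \<open>X\<close> without an edge leaving \<open>X\<close> (the core of \<open>X\<close>). If some edge leaving \<open>X\<close>
  at \<open>u\<close> is strong, then all edges between \<open>u\<close> and the core are weak, so it is never worse to make all
  leaving edges weak and all edges inside \<open>X\<close> strong. Because the inequality is strict, the
  neighbourhoods of removable vertices are equal or disjoint, and they can all be deleted at once.

  In a yes-instance at most \<open>2 k\<close> vertices lie on weak edges. Any other vertex \<open>v\<close> that is left has a clique
  \<open>X\<close> as neighbourhood, and the core of \<open>X\<close> is no larger than the number of edges leaving \<open>X\<close>, all of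
  which are weak. Each weak edge is counted at most twice in this way, which gives another \<open>2 k\<close>
  vertices. Hence no rule has to be applied exhaustively: each vertex is tested once, in the
  input graph, by a constant number of scans of the edge list.
\<close>

section \<open>The reduction rule\<close>

text \<open>The delicate point of deleting all these neighbourhoods together is that an edge between
  two of them leaves both, and that an optimal labeling may keep leaving edges strong. The parameter
  therefore drops by the size of the union of all sets of leaving edges. The matching lower bound
  charges strong leaving edges to weak edges inside the same neighbourhood, and disjointness keeps
  these charges apart. The test of a vertex is pure counting: a set of \<open>d\<close> vertices is
  a clique iff it spans \<open>d * (d - 1) / 2\<close> edges. As the machine cannot multiply, this
  number is accumulated as a triangular number, and \<open>4 * k\<close> is formed by additions. The
  time bound \<open>n * m + 1\<close> is constant for an edgeless graph, however many vertices it
  has, so that case is answered before any loop over the vertices. As soon as there is an edge,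
  \<open>n\<close> and \<open>m\<close> are at most \<open>n * m\<close>, and linear passes over the
  vertices become affordable.\<close>

definition nbh :: "'a set set \<Rightarrow> 'a \<Rightarrow> 'a set" where
  "nbh E v = insert v {u. {v, u} \<in> E}"

definition cut_edges :: "'a set set \<Rightarrow> 'a set \<Rightarrow> 'a set set" where
  "cut_edges E X = {e \<in> E. e \<inter> X \<noteq> {} \<and> \<not> e \<subseteq> X}"

definition core :: "'a set set \<Rightarrow> 'a set \<Rightarrow> 'a set" where
  "core E X = X - \<Union> (cut_edges E X)"

definition clique :: "'a set set \<Rightarrow> 'a set \<Rightarrow> bool" where
  "clique E X \<longleftrightarrow> (\<forall>x\<in>X. \<forall>y\<in>X. x \<noteq> y \<longrightarrow> {x, y} \<in> E)"

text \<open>The core is the paper's critical clique \<open>K\<close>, and the cut edges are those between \<open>N(K)\<close> and \<open>N\<^sup>2(K)\<close>.\<close>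

definition removable :: "'a set set \<Rightarrow> 'a \<Rightarrow> bool" where
  "removable E v \<longleftrightarrow> clique E (nbh E v) \<and> card (cut_edges E (nbh E v)) < card (core E (nbh E v))"

text \<open>A set of vertex sets, so that several removable vertices with the same closed
  neighbourhood yield one piece and sums over pieces count it once.\<close>

definition pieces :: "'a set \<Rightarrow> 'a set set \<Rightarrow> 'a set set" where
  "pieces V E = nbh E ` {v \<in> V. removable E v}"

text \<open>A union rather than a sum of sizes: an edge between two pieces is cut by both but costs
  only one weak edge.\<close>

definition crossing :: "'a set \<Rightarrow> 'a set set \<Rightarrow> 'a set set" where
  "crossing V E = (\<Union>X\<in>pieces V E. cut_edges E X)"

definition remaining :: "'a set \<Rightarrow> 'a set set \<Rightarrow> 'a set set" where
  "remaining V E = {e \<in> E. e \<inter> \<Union> (pieces V E) = {}}"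

section \<open>Closed neighbourhoods, cut edges and cores\<close>

lemma simple_graphD:
  assumes "simple_graph V E"
  shows "finite V" "finite E" "e \<in> E \<Longrightarrow> e \<subseteq> V" "e \<in> E \<Longrightarrow> card e = 2"
proof -
  show V: "finite V" and sub: "e \<in> E \<Longrightarrow> e \<subseteq> V" for e
    using assms by (auto simp: simple_graph_def)
  have "E \<subseteq> Pow V" using sub by blast
  then show "finite E" using V by (meson finite_Pow_iff finite_subset)
  show "e \<in> E \<Longrightarrow> card e = 2" using assms by (auto simp: simple_graph_def)
qed

lemma simple_graph_edge:
  assumes "simple_graph V E" "{u, v} \<in> E"
  shows "u \<noteq> v" "u \<in> V" "v \<in> V"
  using simple_graphD(3,4)[OF assms] by auto

lemma nbh_subset: "simple_graph V E \<Longrightarrow> v \<in> V \<Longrightarrow> nbh E v \<subseteq> V"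
  unfolding nbh_def by (auto dest: simple_graph_edge)

lemma self_in_nbh: "v \<in> nbh E v"
  by (simp add: nbh_def)

lemma clique_subset_nbh: "clique E X \<Longrightarrow> x \<in> X \<Longrightarrow> X \<subseteq> nbh E x"
  unfolding clique_def nbh_def by auto

text \<open>Membership in closed neighbourhoods is symmetric, and a clique lies in the closed
  neighbourhood of each of its members. This gives both inclusions.\<close>

lemma clique_nbh_eq:
  assumes "clique E (nbh E v)" "clique E (nbh E w)" "v \<in> nbh E w"
  shows "nbh E v = nbh E w"
proof -
  have "w \<in> nbh E v" using assms(3) by (auto simp: nbh_def insert_commute)
  then show ?thesis
    using clique_subset_nbh[OF assms(1), of w] clique_subset_nbh[OF assms(2,3)] by simp
qed

lemma cutE:
  assumes "simple_graph V E" "e \<in> cut_edges E X"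
  obtains u w where "e = {u, w}" "{u, w} \<in> E" "u \<in> X" "w \<notin> X" "u \<noteq> w"
proof -
  obtain u w where uw: "u \<in> e" "u \<in> X" "w \<in> e" "w \<notin> X" "e \<in> E"
    using assms(2) unfolding cut_edges_def by blast
  then have "u \<noteq> w" and "card e = 2" using simple_graphD(4)[OF assms(1)] by auto
  moreover have "finite e" using \<open>card e = 2\<close> by (auto intro: card_ge_0_finite)
  ultimately have "e = {u, w}" using uw card_seteq[of e "{u, w}"] by simp
  then show thesis using that uw \<open>u \<noteq> w\<close> by blast
qed

text \<open>No edge at a core vertex leaves \<open>X\<close>, so all its neighbours are in
  \<open>X\<close>; the clique property supplies the converse.\<close>

lemma core_nbh_eq:
  assumes "clique E X" "x \<in> core E X"
  shows "nbh E x = X"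
proof
  have nc: "x \<notin> e" if "e \<in> cut_edges E X" for e
    using assms(2) that by (auto simp: core_def)
  have x: "x \<in> X" using assms(2) by (simp add: core_def)
  show "X \<subseteq> nbh E x" using clique_subset_nbh[OF assms(1) x] .
  show "nbh E x \<subseteq> X"
  proof
    fix u assume "u \<in> nbh E x"
    then consider "u = x" | "{x, u} \<in> E" by (auto simp: nbh_def)
    then show "u \<in> X"
    proof cases
      case 2
      then have "{x, u} \<notin> cut_edges E X" using nc by blast
      then show ?thesis using 2 x by (simp add: cut_edges_def)
    qed (use x in simp)
  qed
qed

text \<open>All neighbours of \<open>v\<close> belong to \<open>nbh E v\<close>, so no edge at
  \<open>v\<close> leaves it. Consequently the cores cover all the vertices from whose
  neighbourhoods they are formed.\<close>

lemma self_in_core: "v \<in> core E (nbh E v)" if "simple_graph V E"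
proof -
  have False if e: "e \<in> cut_edges E (nbh E v)" "v \<in> e" for e
  proof -
    obtain u w where uw: "e = {u, w}" "{u, w} \<in> E" "u \<in> nbh E v" "w \<notin> nbh E v"
      using cutE[OF \<open>simple_graph V E\<close> e(1)] by blast
    then have "v = u" using e(2) self_in_nbh[of v E] by blast
    then show False using uw by (simp add: nbh_def)
  qed
  then show ?thesis using self_in_nbh[of v E] unfolding core_def by auto
qed

text \<open>If two such neighbourhoods overlapped in \<open>u\<close>, then \<open>u\<close> together with each core vertex of
  one would form a cut edge of the other, so each core would be smaller than the other.\<close>

lemma removable_nbh_disjoint:
  assumes G: "simple_graph V E" and r: "removable E v" "removable E w"
    and ne: "nbh E v \<noteq> nbh E w"
  shows "nbh E v \<inter> nbh E w = {}"
proof (rule ccontr)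
  assume "nbh E v \<inter> nbh E w \<noteq> {}"
  then obtain u where u: "u \<in> nbh E v" "u \<in> nbh E w" by blast
  have le: "card (core E (nbh E y)) \<le> card (cut_edges E (nbh E x))"
    if r: "removable E x" "removable E y" and ne: "nbh E x \<noteq> nbh E y"
      and u: "u \<in> nbh E x" "u \<in> nbh E y" for x y
  proof -
    have c: "clique E (nbh E x)" "clique E (nbh E y)" using r by (auto simp: removable_def)
    \<comment> \<open>The closed neighbourhood of a core vertex of one clique is that clique, so a
      core vertex lying in both cliques would make them equal.\<close>
    have out: "z \<notin> nbh E x" if z: "z \<in> core E (nbh E y)" for z
    proof
      assume "z \<in> nbh E x"
      moreover have "nbh E z = nbh E y" using core_nbh_eq[OF c(2) z] .
      ultimately show False using clique_nbh_eq[of E z x] c ne by metis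
    qed
    have "(\<lambda>z. {u, z}) ` core E (nbh E y) \<subseteq> cut_edges E (nbh E x)"
    proof (rule image_subsetI)
      fix z assume z: "z \<in> core E (nbh E y)"
      then have "z \<in> nbh E y" "z \<notin> nbh E x" using out by (auto simp: core_def)
      then show "{u, z} \<in> cut_edges E (nbh E x)"
        using c(2) u unfolding clique_def cut_edges_def by auto
    qed
    moreover have "inj_on (\<lambda>z. {u, z}) (core E (nbh E y))"
      by (auto simp: inj_on_def doubleton_eq_iff)
    moreover have "finite (cut_edges E (nbh E x))" using simple_graphD(2)[OF G] by (simp add: cut_edges_def)
    ultimately show ?thesis using card_inj_on_le by blast
  qed
  show False
    using le[OF r ne u] le[OF r(2,1) ne[symmetric] u(2,1)] r unfolding removable_def by linarith
qed

lemma pieces_disjoint: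
  assumes G: "simple_graph V E" and XY: "X \<in> pieces V E" "Y \<in> pieces V E" "X \<noteq> Y"
  shows "X \<inter> Y = {}"
proof -
  obtain v w where "X = nbh E v" "removable E v" "Y = nbh E w" "removable E w"
    using XY(1,2) unfolding pieces_def by blast
  then show ?thesis using removable_nbh_disjoint[OF G] XY(3) by blast
qed

lemma finite_pieces: "simple_graph V E \<Longrightarrow> finite (pieces V E)"
  unfolding pieces_def by (simp add: simple_graph_def)

lemma pieces_clique: "X \<in> pieces V E \<Longrightarrow> clique E X"
  and pieces_core: "X \<in> pieces V E \<Longrightarrow> card (cut_edges E X) < card (core E X)"
  unfolding pieces_def removable_def by auto

section \<open>Safety of deleting all pieces at once\<close>

lemma stc_labelingD:
  assumes "stc_labeling E S W"
  shows "S \<union> W = E" "S \<inter> W = {}"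
    "{u, v} \<in> S \<Longrightarrow> {v, w} \<in> S \<Longrightarrow> u \<noteq> w \<Longrightarrow> {u, w} \<in> E"
  using assms unfolding stc_labeling_def labeling_def by blast+

text \<open>A strong edge from a core vertex \<open>x\<close> to \<open>u\<close> would, together
  with the strong cut edge at \<open>u\<close>, force an edge leaving \<open>X\<close> at
  \<open>x\<close>. The bound counts only weak edges inside \<open>X\<close>, so that the counts of
  disjoint pieces can be added.\<close>

lemma core_le_weak:
  assumes G: "simple_graph V E" and stc: "stc_labeling E S W" and X: "clique E X"
    and e: "e \<in> cut_edges E X" "e \<in> S"
  shows "card (core E X) \<le> card (W \<inter> Pow X)"
proof -
  obtain u w where uw: "e = {u, w}" "{u, w} \<in> E" "u \<in> X" "w \<notin> X" "u \<noteq> w"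
    using cutE[OF G e(1)] .
  have "(\<lambda>x. {x, u}) ` core E X \<subseteq> W \<inter> Pow X"
  proof (rule image_subsetI)
    fix x assume x: "x \<in> core E X"
    then have xX: "x \<in> X" and nc: "\<And>e. e \<in> cut_edges E X \<Longrightarrow> x \<notin> e" by (auto simp: core_def)
    have "x \<noteq> u" using nc[OF e(1)] uw by auto
    then have "{x, u} \<in> E" using X xX uw by (auto simp: clique_def)
    moreover have "{x, u} \<notin> S"
    proof
      assume "{x, u} \<in> S"
      then have "{x, w} \<in> E" using stc_labelingD(3)[OF stc] e(2) uw xX by blast
      then have "{x, w} \<in> cut_edges E X" using xX uw by (auto simp: cut_edges_def)
      then show False using nc by blast
    qed
    ultimately show "{x, u} \<in> W \<inter> Pow X" using stc_labelingD(1)[OF stc] xX uw(3) by blast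
  qed
  moreover have "inj_on (\<lambda>x. {x, u}) (core E X)" by (auto simp: inj_on_def doubleton_eq_iff)
  moreover have "finite W" using simple_graphD(2)[OF G] stc_labelingD(1)[OF stc] by auto
  ultimately show ?thesis by (meson card_inj_on_le finite_Int)
qed

text \<open>The lower bound: outside the remaining graph every STC-labeling has at least as many
  weak edges as the labeling that makes exactly the crossing edges weak. Crossing edges that are
  already weak pay for themselves; strong ones occur only at \<open>bad\<close> pieces, whose inner
  weak edges pay for all their cut edges.\<close>

lemma crossing_le_weak:
  assumes G: "simple_graph V E" and stc: "stc_labeling E S W"
  shows "card (crossing V E) \<le> card (W - remaining V E)"
proof -
  define bad where "bad = {X \<in> pieces V E. cut_edges E X \<inter> S \<noteq> {}}"
  have fb: "finite bad" using finite_pieces[OF G] by (simp add: bad_def)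
  have fW: "finite W" and SW: "S \<union> W = E" "S \<inter> W = {}"
    using simple_graphD(2)[OF G] stc_labelingD(1,2)[OF stc] by auto
  have ne: "e \<noteq> {}" if "e \<in> E" for e using simple_graphD(4)[OF G that] by auto
  have fc: "finite (crossing V E)"
    using simple_graphD(2)[OF G] finite_pieces[OF G] by (auto simp: crossing_def cut_edges_def)
  have "card (crossing V E \<inter> S) \<le> card (\<Union>X\<in>bad. cut_edges E X)"
    by (rule card_mono) (use fb simple_graphD(2)[OF G] in \<open>auto simp: bad_def crossing_def cut_edges_def\<close>)
  \<comment> \<open>An edge between two bad pieces is counted twice from here on; the inner weak
    edges of both pieces are available to pay for it.\<close>
  also have "\<dots> \<le> (\<Sum>X\<in>bad. card (cut_edges E X))" by (rule card_UN_le[OF fb])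
  also have "\<dots> \<le> (\<Sum>X\<in>bad. card (W \<inter> Pow X))"
  proof (rule sum_mono)
    fix X assume "X \<in> bad"
    then obtain e where X: "X \<in> pieces V E" "e \<in> cut_edges E X" "e \<in> S" by (auto simp: bad_def)
    show "card (cut_edges E X) \<le> card (W \<inter> Pow X)"
      using core_le_weak[OF G stc pieces_clique[OF X(1)] X(2,3)] pieces_core[OF X(1)] by simp
  qed
  also have "\<dots> = card (\<Union>X\<in>bad. W \<inter> Pow X)"
  proof (rule card_UN_disjoint[symmetric])
    show "\<forall>X\<in>bad. \<forall>Y\<in>bad. X \<noteq> Y \<longrightarrow> (W \<inter> Pow X) \<inter> (W \<inter> Pow Y) = {}"
    proof (intro ballI impI)
      fix X Y assume "X \<in> bad" "Y \<in> bad" "X \<noteq> Y"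
      then have "X \<inter> Y = {}" using pieces_disjoint[OF G] by (simp add: bad_def)
      then show "(W \<inter> Pow X) \<inter> (W \<inter> Pow Y) = {}" using ne SW by blast
    qed
  qed (use fb fW in auto)
  finally have S: "card (crossing V E \<inter> S) \<le> card (\<Union>X\<in>bad. W \<inter> Pow X)" .
  have "(\<Union>X\<in>bad. W \<inter> Pow X) \<inter> (crossing V E \<inter> W) = {}"
  proof -
    \<comment> \<open>An edge inside a piece is not cut by that piece, and it does not meet any
      other piece, so no weak edge is charged twice.\<close>
    have False if "e \<in> W" "e \<subseteq> X" "X \<in> pieces V E" "Y \<in> pieces V E" "e \<in> cut_edges E Y" for e X Y
      using that pieces_disjoint[OF G, of X Y] by (auto simp: cut_edges_def)
    then show ?thesis unfolding bad_def crossing_def by blast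
  qed
  then have "card (\<Union>X\<in>bad. W \<inter> Pow X) + card (crossing V E \<inter> W)
      = card ((\<Union>X\<in>bad. W \<inter> Pow X) \<union> (crossing V E \<inter> W))"
    using fb fW by (intro card_Un_disjoint[symmetric]) auto
  also have "\<dots> \<le> card (W - remaining V E)"
  proof (rule card_mono)
    have "e \<notin> remaining V E" if "e \<in> E" "e \<subseteq> X" "X \<in> pieces V E" for e X
    proof -
      have "e \<inter> X \<noteq> {}" using that(2) ne[OF that(1)] by (simp add: Int_absorb2)
      then show ?thesis using that(3) by (auto simp: remaining_def)
    qed
    moreover have "e \<notin> remaining V E" if "e \<in> crossing V E" for e
      using that by (auto simp: remaining_def crossing_def cut_edges_def)
    ultimately show "(\<Union>X\<in>bad. W \<inter> Pow X) \<union> (crossing V E \<inter> W) \<subseteq> W - remaining V E"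
      using SW by (auto simp: bad_def)
  qed (use fW in simp)
  finally have "card (crossing V E \<inter> S) + card (crossing V E \<inter> W) \<le> card (W - remaining V E)"
    using S by simp
  moreover have "card (crossing V E) \<le> card (crossing V E \<inter> S) + card (crossing V E \<inter> W)"
  proof -
    have "crossing V E = (crossing V E \<inter> S) \<union> (crossing V E \<inter> W)"
      using SW by (auto simp: crossing_def cut_edges_def)
    then show ?thesis by (metis card_Un_le)
  qed
  ultimately show ?thesis by simp
qed

text \<open>Forwards, a labeling is restricted; this preserves the closure condition because
  \<open>remaining V E\<close> is the subgraph induced by the vertices outside the pieces, and
  \<open>crossing_le_weak\<close> accounts for the difference in cost. Backwards, the crossing edges
  become weak and the edges inside pieces strong.\<close>

lemma stc_labeling_reduce:
  assumes G: "simple_graph V E"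
  shows "(\<exists>S W. stc_labeling E S W \<and> card W \<le> k) \<longleftrightarrow>
    (\<exists>S W. stc_labeling (remaining V E) S W \<and> card W + card (crossing V E) \<le> k)"
proof
  let ?R = "remaining V E"
  assume "\<exists>S W. stc_labeling E S W \<and> card W \<le> k"
  then obtain S W where stc: "stc_labeling E S W" and k: "card W \<le> k" by blast
  note D = stc_labelingD[OF stc]
  have "stc_labeling ?R (S \<inter> ?R) (W \<inter> ?R)"
    unfolding stc_labeling_def labeling_def
  proof (intro conjI notI)
    show "S \<inter> ?R \<union> W \<inter> ?R = ?R" "S \<inter> ?R \<inter> (W \<inter> ?R) = {}"
      using D(1,2) by (auto simp: remaining_def)
    assume "\<exists>u v w. u \<noteq> w \<and> {u, v} \<in> S \<inter> ?R \<and> {v, w} \<in> S \<inter> ?R \<and> {u, w} \<notin> ?R"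
    then obtain u v w where uvw: "u \<noteq> w" "{u, v} \<in> S" "{u, v} \<in> ?R" "{v, w} \<in> S" "{v, w} \<in> ?R"
      and n: "{u, w} \<notin> ?R" by blast
    have "{u, w} \<in> E" using D(3) uvw by blast
    then show False using uvw n by (auto simp: remaining_def)
  qed
  moreover have "card (W \<inter> ?R) + card (crossing V E) \<le> card W"
  proof -
    have "finite W" using D(1) simple_graphD(2)[OF G] by auto
    then have "card (W \<inter> ?R) + card (W - ?R) = card W"
      by (metis Int_Diff_Un Int_Diff_disjoint card_Un_disjoint finite_Diff finite_Int)
    then show ?thesis using crossing_le_weak[OF G stc] by simp
  qed
  ultimately show "\<exists>S W. stc_labeling ?R S W \<and> card W + card (crossing V E) \<le> k"
    using k by (meson order_trans)
next
  let ?R = "remaining V E" and ?C = "crossing V E"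
  assume "\<exists>S W. stc_labeling ?R S W \<and> card W + card ?C \<le> k"
  then obtain S W where stc: "stc_labeling ?R S W" and k: "card W + card ?C \<le> k" by blast
  note D = stc_labelingD[OF stc]
  have R: "?R \<subseteq> E" and C: "?C \<subseteq> E" by (auto simp: remaining_def crossing_def cut_edges_def)
  have "stc_labeling E (E - (W \<union> ?C)) (W \<union> ?C)"
    unfolding stc_labeling_def labeling_def
  proof (intro conjI notI)
    show "E - (W \<union> ?C) \<union> (W \<union> ?C) = E" "(E - (W \<union> ?C)) \<inter> (W \<union> ?C) = {}"
      using D(1) R C by auto
    assume "\<exists>u v w. u \<noteq> w \<and> {u, v} \<in> E - (W \<union> ?C) \<and> {v, w} \<in> E - (W \<union> ?C) \<and> {u, w} \<notin> E"
    then obtain u v w where uw: "u \<noteq> w" "{u, w} \<notin> E"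
      and uv: "{u, v} \<in> E" "{u, v} \<notin> W" "{u, v} \<notin> ?C"
      and vw: "{v, w} \<in> E" "{v, w} \<notin> W" "{v, w} \<notin> ?C" by blast
    show False
    \<comment> \<open>The middle vertex decides: edges that do not cross keep both ends in its
      clique if it lies in a piece, and both edges belong to the remaining graph otherwise.\<close>
    proof (cases "v \<in> \<Union> (pieces V E)")
      case True
      then obtain X where X: "X \<in> pieces V E" "v \<in> X" by blast
      then have "u \<in> X" "w \<in> X" using uv vw by (auto simp: crossing_def cut_edges_def)
      then show False using pieces_clique[OF X(1)] uw by (simp add: clique_def)
    next
      case False
      then have "u \<notin> \<Union> (pieces V E)" "w \<notin> \<Union> (pieces V E)"
        using uv vw by (auto simp: crossing_def cut_edges_def)
      then have "{u, v} \<in> ?R" "{v, w} \<in> ?R" using False uv vw by (auto simp: remaining_def)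
      then have "{u, v} \<in> S" "{v, w} \<in> S" using D(1) uv vw by blast+
      then show False using D(3) uw R by blast
    qed
  qed
  moreover have "card (W \<union> ?C) \<le> k" using card_Un_le[of W ?C] k by linarith
  ultimately show "\<exists>S W. stc_labeling E S W \<and> card W \<le> k" by blast
qed

text \<open>\<open>U\<close> collects the surviving vertices that touch no weak edge. Their
  neighbourhoods form a disjoint family of cliques, each with at most as many core vertices as cut
  edges. An edge may be cut by two of these cliques, but then through different endpoints; so pairs
  of a weak edge and an endpoint are counted, of which there are \<open>2 * card W\<close>.\<close>

lemma remaining_vertices_le:
  assumes G: "simple_graph V E" and stc: "stc_labeling E S W"
  shows "card (V - \<Union> (pieces V E)) \<le> 4 * card W"
proof -
  note D = stc_labelingD[OF stc]
  have fW: "finite W" and fV: "finite V" using simple_graphD(1,2)[OF G] D(1) by auto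
  have card2: "card e = 2" if "e \<in> W" for e using that D(1) simple_graphD(4)[OF G] by blast
  have fin: "finite e" if "e \<in> W" for e
    using card2[OF that] by (intro card_ge_0_finite) simp
  define U where "U = V - \<Union> (pieces V E) - \<Union> W"
  have strong: "{v, u} \<in> S" "{u, v} \<in> S" if "v \<in> U" "{v, u} \<in> E" for v u
  proof -
    have "{v, u} \<notin> W" using that(1) by (auto simp: U_def)
    then show "{v, u} \<in> S" using that(2) D(1) by blast
    then show "{u, v} \<in> S" by (simp add: insert_commute)
  qed
  have cl: "clique E (nbh E v)" if v: "v \<in> U" for v
    unfolding clique_def
  proof (intro ballI impI)
    fix x y assume xy: "x \<in> nbh E v" "y \<in> nbh E v" "x \<noteq> y"
    show "{x, y} \<in> E"
    proof (cases "x = v \<or> y = v")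
      case True
      then show ?thesis using xy by (auto simp: nbh_def insert_commute)
    next
      case False
      then show ?thesis using xy strong[OF v] D(3)[of x v y] by (simp add: nbh_def)
    qed
  qed
  have disj: "nbh E v \<inter> nbh E w = {}" if vw: "v \<in> U" "w \<in> U" "nbh E v \<noteq> nbh E w" for v w
  proof (rule ccontr)
    assume "nbh E v \<inter> nbh E w \<noteq> {}"
    then obtain u where u: "u \<in> nbh E v" "u \<in> nbh E w" by blast
    \<comment> \<open>A common neighbour is joined to both \<open>v\<close> and \<open>w\<close> by
      strong edges, so closure makes \<open>v\<close> and \<open>w\<close> adjacent.\<close>
    have "v \<in> nbh E w"
    proof (cases "u = v \<or> u = w \<or> v = w")
      case True
      then show ?thesis using u by (auto simp: nbh_def insert_commute)
    next
      case False
      then have "{u, v} \<in> S" "{w, u} \<in> S" using u strong vw by (auto simp: nbh_def)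
      then have "{w, v} \<in> E" using D(3)[of w u v] False by blast
      then show ?thesis by (simp add: nbh_def)
    qed
    then show False using clique_nbh_eq[of E v w] cl vw by simp
  qed
  \<comment> \<open>If an edge leaves the neighbourhood at \<open>u\<close>, then
    \<open>{v, u}\<close> is strong and the outer endpoint is not adjacent to \<open>v\<close>; so
    the edge cannot be strong.\<close>
  have weak: "cut_edges E (nbh E v) \<subseteq> W" if v: "v \<in> U" for v
  proof
    fix e assume "e \<in> cut_edges E (nbh E v)"
    then obtain u w where uw: "e = {u, w}" "{u, w} \<in> E" "u \<in> nbh E v" "w \<notin> nbh E v"
      using cutE[OF G] by metis
    then have "u \<noteq> v" "{v, w} \<notin> E" "v \<noteq> w" by (auto simp: nbh_def)
    moreover have "{v, u} \<in> S" using uw(3) \<open>u \<noteq> v\<close> strong[OF v] by (auto simp: nbh_def)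
    ultimately have "{u, w} \<notin> S" using D(3) by blast
    then show "e \<in> W" using uw D(1) by blast
  qed
  define N where "N = nbh E ` U"
  have fU: "finite U" and fN: "finite N" using fV by (auto simp: U_def N_def)
  have fX: "finite X" if "X \<in> N" for X
    using that nbh_subset[OF G] finite_subset[OF _ fV] by (auto simp: N_def U_def)
  have cc: "card (core E X) \<le> card (cut_edges E X)" if "X \<in> N" for X
  proof -
    obtain v where v: "v \<in> U" "X = nbh E v" using \<open>X \<in> N\<close> by (auto simp: N_def)
    \<comment> \<open>A removable vertex lies in its own piece, which \<open>U\<close> avoids. The
      clique condition does hold, so it is the strict inequality that fails.\<close>
    have "\<not> removable E v" using v(1) self_in_nbh[of v E] by (auto simp: U_def pieces_def)
    then show ?thesis using cl v by (auto simp: removable_def)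
  qed
  have "card U \<le> card (\<Union>X\<in>N. core E X)"
  proof (rule card_mono)
    show "finite (\<Union>X\<in>N. core E X)" using fN fX by (auto simp: core_def)
    show "U \<subseteq> (\<Union>X\<in>N. core E X)" using self_in_core[OF G] by (auto simp: N_def)
  qed
  also have "\<dots> \<le> (\<Sum>X\<in>N. card (core E X))" by (rule card_UN_le[OF fN])
  also have "\<dots> \<le> (\<Sum>X\<in>N. card (SIGMA e:W. e \<inter> X))"
  proof (rule sum_mono)
    fix X assume X: "X \<in> N"
    have "cut_edges E X \<subseteq> fst ` (SIGMA e:W. e \<inter> X)"
    proof
      fix e assume e: "e \<in> cut_edges E X"
      then obtain u where "u \<in> e \<inter> X" by (auto simp: cut_edges_def)
      moreover have "e \<in> W" using X weak e by (auto simp: N_def)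
      ultimately show "e \<in> fst ` (SIGMA e:W. e \<inter> X)" by force
    qed
    then have "card (cut_edges E X) \<le> card (SIGMA e:W. e \<inter> X)"
      by (rule surj_card_le[rotated]) (use fW fX[OF X] in auto)
    then show "card (core E X) \<le> card (SIGMA e:W. e \<inter> X)" using cc[OF X] by simp
  qed
  also have "\<dots> = card (\<Union>X\<in>N. SIGMA e:W. e \<inter> X)"
  proof (rule card_UN_disjoint[symmetric])
    show "\<forall>X\<in>N. \<forall>Y\<in>N. X \<noteq> Y \<longrightarrow> (SIGMA e:W. e \<inter> X) \<inter> (SIGMA e:W. e \<inter> Y) = {}"
    proof (intro ballI impI)
      fix X Y assume "X \<in> N" "Y \<in> N" "X \<noteq> Y"
      then have "X \<inter> Y = {}" using disj by (auto simp: N_def)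
      then show "(SIGMA e:W. e \<inter> X) \<inter> (SIGMA e:W. e \<inter> Y) = {}" by blast
    qed
  qed (use fN fW fX in auto)
  also have "\<dots> \<le> card (SIGMA e:W. e)"
    by (rule card_mono) (use fW fin in \<open>auto intro!: finite_SigmaI\<close>)
  also have "\<dots> = 2 * card W"
    using fW fin card2 by (subst card_SigmaI) auto
  finally have U: "card U \<le> 2 * card W" .
  have "card (\<Union> W) \<le> 2 * card W"
    using card_Union_le_sum_card[of W] card2 by simp
  moreover have "card (V - \<Union> (pieces V E)) \<le> card (U \<union> \<Union> W)"
    by (rule card_mono) (use fU fW fin in \<open>auto simp: U_def\<close>)
  moreover have "card (U \<union> \<Union> W) \<le> card U + card (\<Union> W)" by (rule card_Un_le)
  ultimately show ?thesis using U by linarith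
qed

section \<open>Invariance under renaming of vertices\<close>

lemma stc_labeling_image:
  assumes f: "inj_on f V" and E: "E \<subseteq> Pow V" and stc: "stc_labeling E S W"
  shows "stc_labeling ((`) f ` E) ((`) f ` S) ((`) f ` W)"
proof -
  note D = stc_labelingD[OF stc]
  let ?g = "inv_into V f"
  have inv: "?g ` e' \<in> T" "e' \<subseteq> f ` V" 
    if T: "e' \<in> (`) f ` T" "T \<subseteq> E" for T e'
  proof -
    obtain e where e: "e' = f ` e" "e \<in> T" using T(1) by (rule imageE)
    have "e \<subseteq> V" using e(2) T(2) E by blast
    note e = e this
    then show "?g ` e' \<in> T" "e' \<subseteq> f ` V"
      using inv_into_image_cancel[OF f e(3)] by (simp_all add: image_mono)
  qed
  show ?thesis
    unfolding stc_labeling_def labeling_def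
  proof (intro conjI notI)
    show "(`) f ` S \<union> (`) f ` W = (`) f ` E"
      by (simp add: D(1) flip: image_Un)
    show "(`) f ` S \<inter> (`) f ` W = {}"
    proof -
      have "inj_on ((`) f) (Pow V)" using f by (rule inj_on_image_Pow)
      then have "(`) f ` S \<inter> (`) f ` W = (`) f ` (S \<inter> W)"
        using D(1) E by (intro inj_on_image_Int[symmetric]) auto
      then show ?thesis using D(2) by simp
    qed
    assume "\<exists>u v w. u \<noteq> w \<and> {u, v} \<in> (`) f ` S \<and> {v, w} \<in> (`) f ` S \<and> {u, w} \<notin> (`) f ` E"
    then obtain u v w where uw: "u \<noteq> w" "{u, w} \<notin> (`) f ` E"
      and uv: "{u, v} \<in> (`) f ` S" and vw: "{v, w} \<in> (`) f ` S" by (elim exE conjE)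
    have "S \<subseteq> E" using D(1) by blast
    have in_V: "u \<in> f ` V" "w \<in> f ` V"
      using inv(2)[OF uv \<open>S \<subseteq> E\<close>] inv(2)[OF vw \<open>S \<subseteq> E\<close>] by simp_all
    then have "?g u \<noteq> ?g w" using uw(1) by (metis f_inv_into_f)
    then have "{?g u, ?g w} \<in> E"
      using inv(1)[OF uv \<open>S \<subseteq> E\<close>] inv(1)[OF vw \<open>S \<subseteq> E\<close>] D(3)[of "?g u" "?g v" "?g w"]
      by simp
    then have "f ` {?g u, ?g w} \<in> (`) f ` E" by (rule imageI)
    then show False using in_V uw(2) by (simp add: f_inv_into_f)
  qed
qed

lemma simple_graph_image:
  assumes "inj_on f V" "simple_graph V E"
  shows "simple_graph (f ` V) ((`) f ` E)"
proof -
  have "f ` e \<in> {{u, v} |u v. u \<in> f ` V \<and> v \<in> f ` V \<and> u \<noteq> v}" if e: "e \<in> E" for e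
  proof -
    obtain u v where "e = {u, v}" "u \<in> V" "v \<in> V" "u \<noteq> v"
      using assms(2) e unfolding simple_graph_def by blast
    moreover have "f u \<noteq> f v" using assms(1) calculation by (auto dest: inj_onD)
    ultimately show ?thesis by auto
  qed
  then have "(`) f ` E \<subseteq> {{u, v} |u v. u \<in> f ` V \<and> v \<in> f ` V \<and> u \<noteq> v}"
    by (rule image_subsetI)
  then show ?thesis using assms(2) by (simp only: simple_graph_def finite_imageI)
qed

lemma strong_triadic_closure_image:
  assumes f: "inj_on f V" and G: "simple_graph V E"
  shows "strong_triadic_closure (f ` V) ((`) f ` E) k \<longleftrightarrow> strong_triadic_closure V E k"
proof -
  \<comment> \<open>Only one direction is proved, with fresh type variables, since it is applied to
    \<open>f\<close> and, in the opposite direction, to its inverse.\<close>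
  have imp: "strong_triadic_closure (h ` V') ((`) h ` E') k"
    if h: "inj_on h V'" and yes: "strong_triadic_closure V' E' k"
    for h :: "'c \<Rightarrow> 'd" and V' and E' :: "'c set set"
  proof -
    obtain S W where G': "simple_graph V' E'" and stc: "stc_labeling E' S W" and k: "card W \<le> k"
      using yes by (auto simp: strong_triadic_closure_def)
    have "E' \<subseteq> Pow V'" using simple_graphD(3)[OF G'] by blast
    then have "stc_labeling ((`) h ` E') ((`) h ` S) ((`) h ` W)"
      by (rule stc_labeling_image[OF h _ stc])
    moreover have "card ((`) h ` W) \<le> k"
    proof -
      have "finite W" using stc_labelingD(1)[OF stc] simple_graphD(2)[OF G'] by auto
      then show ?thesis using k card_image_le[of W "(`) h"] by simp
    qed
    ultimately show ?thesis
      using simple_graph_image[OF h G'] unfolding strong_triadic_closure_def by blast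
  qed
  have "inv_into V f ` f ` V = V" using f by simp
  moreover have "(`) (inv_into V f) ` (`) f ` E = E"
  proof -
    have "inv_into V f ` f ` e = e" if "e \<in> E" for e
      using inv_into_image_cancel[OF f] simple_graphD(3)[OF G that] .
    then show ?thesis by (simp add: image_image)
  qed
  moreover have "inj_on (inv_into V f) (f ` V)" by (rule inj_on_inv_into) simp
  ultimately show ?thesis
    using imp[OF f, of E] imp[of "inv_into V f" "f ` V" "(`) f ` E"] by metis
qed

text \<open>The edges inside \<open>X\<close> are among its two-element subsets, so equality of the
  finite cardinalities means that all of these are edges. It turns the clique test into a single
  edge count; the factor 2 avoids division.\<close>

lemma clique_iff_card:
  assumes G: "simple_graph V E" and X: "finite X"
  shows "clique E X \<longleftrightarrow> 2 * card {e \<in> E. e \<subseteq> X} = card X * (card X - 1)"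
proof -
  let ?P = "{e. e \<subseteq> X \<and> card e = 2}"
  have sub: "{e \<in> E. e \<subseteq> X} \<subseteq> ?P" using simple_graphD(4)[OF G] by auto
  have fP: "finite ?P" using X by (auto intro: finite_subset[of _ "Pow X"])
  \<comment> \<open>Needed to undo the integer division in the formula for
    \<open>n choose 2\<close>.\<close>
  have "even (card X * (card X - 1))" by (cases "card X") auto
  then have c: "2 * card ?P = card X * (card X - 1)"
    using n_subsets[OF X, of 2] by (simp add: choose_two)
  have "clique E X \<longleftrightarrow> {e \<in> E. e \<subseteq> X} = ?P"
  proof
    assume "clique E X"
    then have "?P \<subseteq> {e \<in> E. e \<subseteq> X}" by (auto simp: clique_def card_2_iff)
    then show "{e \<in> E. e \<subseteq> X} = ?P" using sub by blast
  next
    assume eq: "{e \<in> E. e \<subseteq> X} = ?P"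
    have "{x, y} \<in> {e \<in> E. e \<subseteq> X}" if "x \<in> X" "y \<in> X" "x \<noteq> y" for x y
      using that unfolding eq by simp
    then show "clique E X" unfolding clique_def by blast
  qed
  also have "\<dots> \<longleftrightarrow> card {e \<in> E. e \<subseteq> X} = card ?P"
    using card_subset_eq[OF fP sub] by auto
  finally show ?thesis using c by auto
qed

section \<open>Reasoning about programs\<close>

text \<open>Total correctness with an upper bound on time, so that costs can be rounded up by
  \<open>reach_mono\<close>. Since \<open>exec\<close> is deterministic, the existence of one run
  says everything.\<close>

definition reach :: "com \<Rightarrow> state \<Rightarrow> nat \<Rightarrow> (state \<Rightarrow> bool) \<Rightarrow> bool" where
  "reach c s T Q \<longleftrightarrow> (\<exists>t s'. exec c s t s' \<and> t \<le> T \<and> Q s')"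

lemma reach_mono:
  "reach c s T P \<Longrightarrow> T \<le> T' \<Longrightarrow> (\<And>s'. P s' \<Longrightarrow> Q s') \<Longrightarrow> reach c s T' Q"
  unfolding reach_def by (meson order_trans)

text \<open>The claim about the second program is the postcondition of the first, which makes the
  bound \<open>T'\<close> uniform in the intermediate state.\<close>

lemma reach_Seq:
  "reach c s T (\<lambda>s'. reach d s' T' Q) \<Longrightarrow> reach (Seq c d) s (T + T') Q"
  unfolding reach_def by (meson exec.Seq add_mono)

lemma reach_If:
  assumes "bval b s \<Longrightarrow> reach c s T Q" "\<not> bval b s \<Longrightarrow> reach d s T Q"
  shows "reach (If b c d) s (bcost b + T + 1) Q"
  using assms exec.IfTrue exec.IfFalse unfolding reach_def
  by (cases "bval b s") (meson add_le_mono le_refl)+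

text \<open>For loops with a known number \<open>N\<close> of iterations: the invariant carries the
  iteration count, and the test fails exactly at \<open>N\<close>. The last summand pays for that
  failing test.\<close>

lemma reach_While:
  assumes body: "\<And>i s. i < N \<Longrightarrow> I i s \<Longrightarrow> reach c s T (I (Suc i))"
    and test: "\<And>i s. I i s \<Longrightarrow> i \<le> N \<Longrightarrow> bval b s \<longleftrightarrow> i < N"
    and init: "I 0 s"
  shows "reach (While b c) s (N * (bcost b + T + 1) + bcost b + 1) (I N)"
proof -
  have "reach (While b c) s ((N - i) * (bcost b + T + 1) + bcost b + 1) (I N)"
    if "I i s" "i \<le> N" for i s
    using that
  proof (induction "N - i" arbitrary: i s)
    case 0
    then show ?case using test[of i s] by (auto simp: reach_def intro!: exI exec.WhileFalse)
  next
    case (Suc d)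
    then have i: "i < N" and b: "bval b s" using test[of i s] by auto
    obtain t s1 where 1: "exec c s t s1" "t \<le> T" "I (Suc i) s1"
      using body[OF i Suc.prems(1)] unfolding reach_def by blast
    have "reach (While b c) s1 ((N - Suc i) * (bcost b + T + 1) + bcost b + 1) (I N)"
      using Suc 1(3) i by simp
    then obtain t' s2 where 2: "exec (While b c) s1 t' s2" "I N s2"
      "t' \<le> (N - Suc i) * (bcost b + T + 1) + bcost b + 1" unfolding reach_def by blast
    have "N - i = Suc (N - Suc i)" using i by simp
    then have "bcost b + t + t' + 1 \<le> (N - i) * (bcost b + T + 1) + bcost b + 1"
      using 1(2) 2(3) by simp
    then show ?case using exec.WhileTrue[OF b 1(1) 2(1)] 2(2) unfolding reach_def by blast
  qed
  from this[OF init] show ?thesis by simp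
qed

section \<open>Loop-free programs: computed result and cost bound\<close>

primrec loop_free :: "com \<Rightarrow> bool" where
  "loop_free Skip \<longleftrightarrow> True"
| "loop_free (Assign x p) \<longleftrightarrow> True"
| "loop_free (Put a i p) \<longleftrightarrow> True"
| "loop_free (Seq c d) \<longleftrightarrow> loop_free c \<and> loop_free d"
| "loop_free (If b c d) \<longleftrightarrow> loop_free c \<and> loop_free d"
| "loop_free (While b c) \<longleftrightarrow> False"

text \<open>A conditional is charged for both branches; a sum instead of a maximum keeps all bounds
  linear in the costs of the parts.\<close>

primrec cost :: "com \<Rightarrow> nat" where
  "cost Skip = 1"
| "cost (Assign x p) = acost p + 1"
| "cost (Put a i p) = acost i + acost p + 1"
| "cost (Seq c d) = cost c + cost d"
| "cost (If b c d) = bcost b + (cost c + cost d) + 1"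
| "cost (While b c) = 0"

text \<open>Only meaningful for loop-free programs, as is \<open>cost\<close>.\<close>

primrec result :: "com \<Rightarrow> state \<Rightarrow> state" where
  "result Skip s = s"
| "result (Assign x p) s = s\<lparr>vars := (vars s)(x := aval p s)\<rparr>"
| "result (Put a i p) s = s\<lparr>arrs := (arrs s)(a := (arrs s a)(aval i s := aval p s))\<rparr>"
| "result (Seq c d) s = result d (result c s)"
| "result (If b c d) s = (if bval b s then result c s else result d s)"
| "result (While b c) s = s"

lemma reach_loop_free: "loop_free c \<Longrightarrow> Q (result c s) \<Longrightarrow> reach c s (cost c) Q"
proof (induction c arbitrary: s Q)
  case (Seq c d)
  then show ?case by (auto intro!: reach_Seq)
next
  case (If b c d)
  have "reach (com.If b c d) s (bcost b + (cost c + cost d) + 1) Q"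
  proof (rule reach_If)
    assume "bval b s"
    then have "reach c s (cost c) Q" using If by simp
    then show "reach c s (cost c + cost d) Q" by (rule reach_mono) simp_all
  next
    assume "\<not> bval b s"
    then have "reach d s (cost d) Q" using If by simp
    then show "reach d s (cost c + cost d) Q" by (rule reach_mono) simp_all
  qed
  then show ?case by simp
qed (auto simp: reach_def intro!: exI intro: exec.intros)

lemma reach_Seq_loop_free:
  "loop_free c \<Longrightarrow> reach d (result c s) T Q \<Longrightarrow> reach (Seq c d) s (cost c + T) Q"
  by (intro reach_Seq reach_loop_free)

section \<open>The program\<close>

text \<open>Names of variables (\<open>v\<dots>\<close>) and arrays (\<open>a\<dots>\<close>); arrays 0 and 1 hold the edge list.\<close>

abbreviation (input) "vN \<equiv> 0 :: nat"
abbreviation (input) "vM \<equiv> 1 :: nat"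
abbreviation (input) "vK \<equiv> 2 :: nat"
abbreviation (input) "vI \<equiv> 3 :: nat"
abbreviation (input) "vX \<equiv> 4 :: nat"
abbreviation (input) "vY \<equiv> 5 :: nat"
abbreviation (input) "vV \<equiv> 6 :: nat"
abbreviation (input) "vU \<equiv> 7 :: nat"
abbreviation (input) "vDeg \<equiv> 8 :: nat"
abbreviation (input) "vTri \<equiv> 9 :: nat"
abbreviation (input) "vInner \<equiv> 10 :: nat"
abbreviation (input) "vCut \<equiv> 11 :: nat"
abbreviation (input) "vCore \<equiv> 12 :: nat"
abbreviation (input) "vCross \<equiv> 13 :: nat"
abbreviation (input) "vN' \<equiv> 14 :: nat"
abbreviation (input) "vM' \<equiv> 15 :: nat"

abbreviation (input) "aMark \<equiv> 2 :: nat"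
abbreviation (input) "aFlag \<equiv> 3 :: nat"
abbreviation (input) "aPiece \<equiv> 4 :: nat"
abbreviation (input) "aIndex \<equiv> 5 :: nat"
abbreviation (input) "aFst \<equiv> 6 :: nat"
abbreviation (input) "aSnd \<equiv> 7 :: nat"

definition incr :: "nat \<Rightarrow> com" where
  "incr x = Assign x (Add (Var x) (Num 1))"

definition for_edges :: "com \<Rightarrow> com" where
  "for_edges c = Seq (Assign vI (Num 0)) (While (Less (Var vI) (Var vM))
     (Seq (Seq (Assign vX (Get 0 (Var vI))) (Seq (Assign vY (Get 1 (Var vI))) c)) (incr vI)))"

text \<open>There are no adjacency lists: neighbours are found by scanning the unsorted edge list,
  at a cost linear in \<open>m\<close>, which the time bound allows a constant number of times per
  vertex.\<close>

definition for_neighbours :: "com \<Rightarrow> com" where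
  "for_neighbours c = for_edges
     (If (Equal (Var vX) (Var vV)) (Seq (Assign vU (Var vY)) c)
     (If (Equal (Var vY) (Var vV)) (Seq (Assign vU (Var vX)) c) Skip))"

text \<open>Per edge, loading the endpoints takes 6 steps, the increment 4 and the loop test 4; the
  final 6 pays for the initial assignment and the failing test.\<close>

definition edges_cost :: "nat \<Rightarrow> com \<Rightarrow> nat" where
  "edges_cost m c = m * (cost c + 14) + 6"

text \<open>The body \<open>c\<close> occurs in two branches, hence the factor 2; the constant 40 is
  rounded up from 27.\<close>

definition neighbours_cost :: "nat \<Rightarrow> com \<Rightarrow> nat" where
  "neighbours_cost m c = m * (2 * cost c + 40) + 6"

locale edge_list =
  fixes n :: nat and E :: "nat set set" and k :: nat and A B :: "nat \<Rightarrow> nat"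
  assumes graph: "simple_graph {..<n} E"
    and bij: "bij_betw (\<lambda>i. {A i, B i}) {..<card E} E"
begin

text \<open>The part of the state that every phase preserves until the output is written over
  it.\<close>

definition holds_input :: "state \<Rightarrow> bool" where
  "holds_input s \<longleftrightarrow> vars s vN = n \<and> vars s vM = card E \<and> vars s vK = k \<and> arrs s 0 = A \<and> arrs s 1 = B"

text \<open>The invariant speaks of the set of edges scanned so far, not of a position in the list,
  so that counters can be cardinalities. Injectivity of the list makes each edge new when it is
  reached. \<open>indep\<close> keeps the invariant from reading the variables that the loop itself
  changes.\<close>

lemma reach_for_edges:
  assumes lf: "loop_free c"
    and step: "\<And>F s. F \<subseteq> E \<Longrightarrow> {vars s vX, vars s vY} \<in> E - F \<Longrightarrow> vars s vX \<noteq> vars s vY \<Longrightarrow>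
      holds_input s \<Longrightarrow> I F s \<Longrightarrow>
      holds_input (result c s) \<and> vars (result c s) vI = vars s vI \<and>
      I (insert {vars s vX, vars s vY} F) (result c s)"
    and indep: "\<And>F s z a. z \<in> {vI, vX, vY} \<Longrightarrow> I F (s\<lparr>vars := (vars s)(z := a)\<rparr>) = I F s"
    and init: "holds_input s" "I {} s"
  shows "reach (for_edges c) s (edges_cost (card E) c) (\<lambda>s. holds_input s \<and> I E s)"
proof -
  let ?e = "\<lambda>i. {A i, B i}"
  let ?get = "Seq (Assign vX (Get 0 (Var vI))) (Seq (Assign vY (Get 1 (Var vI))) c)"
  let ?body = "Seq ?get (incr vI)"
  let ?test = "Less (Var vI) (Var vM)"
  let ?J = "\<lambda>i s. holds_input s \<and> vars s vI = i \<and> I (?e ` {..<i}) s"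
  have inj: "inj_on ?e {..<card E}" and im: "?e ` {..<card E} = E"
    using bij by (auto simp: bij_betw_def)
  have "reach (While ?test ?body) (s\<lparr>vars := (vars s)(vI := 0)\<rparr>)
      (card E * (bcost ?test + cost ?body + 1) + bcost ?test + 1) (?J (card E))"
  proof (rule reach_While)
    fix i s assume i: "i < card E" and J: "?J i s"
    let ?s = "s\<lparr>vars := (vars s)(vX := A i, vY := B i)\<rparr>"
    have e: "?e i \<in> E - ?e ` {..<i}"
    proof
      show "?e i \<in> E" using i im by blast
      show "?e i \<notin> ?e ` {..<i}"
      proof
        assume "?e i \<in> ?e ` {..<i}"
        then obtain j where "?e i = ?e j" "j < i" by (elim imageE) simp
        then show False using inj_onD[OF inj, of i j] i by simp
      qed
    qed
    have "I (?e ` {..<i}) (s\<lparr>vars := (vars s)(vX := A i)\<rparr>)" using J indep by simp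
    then have "I (?e ` {..<i}) ?s"
      using indep[of vY _ "s\<lparr>vars := (vars s)(vX := A i)\<rparr>" "B i"] by simp
    moreover have "?e ` {..<i} \<subseteq> E" using im i by auto
    moreover have "A i \<noteq> B i" using simple_graph_edge(1)[OF graph] e by blast
    ultimately have 1: "holds_input (result c ?s)" "vars (result c ?s) vI = i"
        "I (insert (?e i) (?e ` {..<i})) (result c ?s)"
      using step[of "?e ` {..<i}" ?s] e J by (auto simp: holds_input_def)
    have 2: "result ?get s = result c ?s"
      using J by (simp add: holds_input_def)
    have "?J (Suc i) (result ?body s)"
      unfolding result.simps(4)[of _ "incr vI"] 2
      using 1 indep[of vI] by (simp add: incr_def holds_input_def lessThan_Suc)
    moreover have "loop_free ?body" using lf by (simp add: incr_def)
    ultimately show "reach ?body s (cost ?body) (?J (Suc i))"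
      using reach_loop_free[where Q = "?J (Suc i)"] by blast
  next
    show "?J 0 (s\<lparr>vars := (vars s)(vI := 0)\<rparr>)" using init indep by (simp add: holds_input_def)
  qed (simp add: holds_input_def)
  then have "reach (Seq (Assign vI (Num 0)) (While ?test ?body)) s
      (cost (Assign vI (Num 0)) + (card E * (bcost ?test + cost ?body + 1) + bcost ?test + 1)) (?J (card E))"
    by (intro reach_Seq_loop_free) simp_all
  then show ?thesis
    unfolding for_edges_def
    by (rule reach_mono) (auto simp: edges_cost_def im incr_def algebra_simps)
qed

text \<open>After the edges in \<open>F\<close> the visited set is \<open>nbh F v\<close>, which is
  \<open>{v}\<close> at the start; simplicity of the graph ensures that each neighbour is met by
  exactly one edge.\<close>

lemma reach_for_neighbours:
  assumes lf: "loop_free c"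
    and step: "\<And>M s. {v, vars s vU} \<in> E \<Longrightarrow> M \<subseteq> nbh E v \<Longrightarrow> v \<in> M \<Longrightarrow> vars s vU \<notin> M \<Longrightarrow>
      holds_input s \<Longrightarrow> vars s vV = v \<Longrightarrow> I M s \<Longrightarrow>
      holds_input (result c s) \<and> vars (result c s) vV = v \<and> vars (result c s) vI = vars s vI \<and>
      I (insert (vars s vU) M) (result c s)"
    and indep: "\<And>F s z a. z \<in> {vI, vX, vY, vU} \<Longrightarrow> I F (s\<lparr>vars := (vars s)(z := a)\<rparr>) = I F s"
    and init: "holds_input s" "vars s vV = v" "I {v} s"
  shows "reach (for_neighbours c) s (neighbours_cost (card E) c)
    (\<lambda>s. holds_input s \<and> vars s vV = v \<and> I (nbh E v) s)"
proof -
  let ?c = "If (Equal (Var vX) (Var vV)) (Seq (Assign vU (Var vY)) c)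
     (If (Equal (Var vY) (Var vV)) (Seq (Assign vU (Var vX)) c) Skip)"
  let ?J = "\<lambda>F s. vars s vV = v \<and> I (nbh F v) s"
  have "reach (for_edges ?c) s (edges_cost (card E) ?c) (\<lambda>s. holds_input s \<and> ?J E s)"
  proof (rule reach_for_edges)
    fix F s
    assume F: "F \<subseteq> E" and e: "{vars s vX, vars s vY} \<in> E - F" and ne: "vars s vX \<noteq> vars s vY"
      and h: "holds_input s" and J: "?J F s"
    have nb: "nbh F v \<subseteq> nbh E v" "v \<in> nbh F v" using F by (auto simp: nbh_def)
    have use: "holds_input (result c (s\<lparr>vars := (vars s)(vU := u)\<rparr>)) \<and>
        vars (result c (s\<lparr>vars := (vars s)(vU := u)\<rparr>)) vI = vars s vI \<and>
        ?J (insert {v, u} F) (result c (s\<lparr>vars := (vars s)(vU := u)\<rparr>))"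
      if u: "{v, u} \<in> E - F" "u \<noteq> v" for u
    proof -
      have "u \<notin> nbh F v" using u by (simp add: nbh_def)
      moreover have "nbh (insert {v, u} F) v = insert u (nbh F v)"
        using u by (auto simp: nbh_def doubleton_eq_iff)
      ultimately show ?thesis
        using step[of "s\<lparr>vars := (vars s)(vU := u)\<rparr>" "nbh F v"] u nb h J indep[of vU]
        by (simp add: holds_input_def)
    qed
    consider "vars s vX = v" | "vars s vX \<noteq> v" "vars s vY = v" | "vars s vX \<noteq> v" "vars s vY \<noteq> v"
      by blast
    then show "holds_input (result ?c s) \<and> vars (result ?c s) vI = vars s vI \<and>
        ?J (insert {vars s vX, vars s vY} F) (result ?c s)"
    proof cases
      case 1
      then show ?thesis using use[of "vars s vY"] e ne J by simp
    next
      case 2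
      then have "{vars s vX, vars s vY} = {v, vars s vX}" by blast
      then show ?thesis using 2 use[of "vars s vX"] e J by simp
    next
      case 3
      then have "nbh (insert {vars s vX, vars s vY} F) v = nbh F v"
        by (auto simp: nbh_def doubleton_eq_iff)
      then show ?thesis using 3 h J by simp
    qed
  next
    show "?J {} s" using init by (simp add: nbh_def)
  qed (use lf indep init in auto)
  then show ?thesis
    unfolding for_neighbours_def
    by (rule reach_mono) (auto simp: edges_cost_def neighbours_cost_def)
qed

end

text \<open>
  When vertex \<open>v\<close> is processed, marks and flags are written as the stamp \<open>v + 1\<close>, so that older entries
  are invalid without being erased. Erasing them, or any other scan of all vertices, would cost
  time \<open>n\<close> per vertex, which is too much when there are many isolated vertices.
\<close>

definition marked :: "nat \<Rightarrow> bexp" where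
  "marked x = Equal (Get aMark (Var x)) (Add (Var vV) (Num 1))"

text \<open>\<open>vTri\<close> becomes \<open>1 + 2 + \<dots> + deg v\<close>, the number of edges of a clique with \<open>deg v + 1\<close> vertices.\<close>

definition mark_step :: com where
  "mark_step = Seq (Put aMark (Var vU) (Add (Var vV) (Num 1)))
     (Seq (incr vDeg) (Assign vTri (Add (Var vTri) (Var vDeg))))"

definition mark :: com where
  "mark = Seq (Seq (Put aMark (Var vV) (Add (Var vV) (Num 1)))
     (Seq (Assign vDeg (Num 0)) (Assign vTri (Num 0)))) (for_neighbours mark_step)"

definition classify_step :: com where
  "classify_step = If (marked vX)
     (If (marked vY) (incr vInner) (Seq (incr vCut) (Put aFlag (Var vX) (Add (Var vV) (Num 1)))))
     (If (marked vY) (Seq (incr vCut) (Put aFlag (Var vY) (Add (Var vV) (Num 1)))) Skip)"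

definition classify :: com where
  "classify = Seq (Seq (Assign vInner (Num 0)) (Assign vCut (Num 0))) (for_edges classify_step)"

definition core_step :: com where
  "core_step = If (Equal (Get aFlag (Var vU)) (Add (Var vV) (Num 1))) Skip (incr vCore)"

text \<open>The count starts at 1 for the vertex itself, which always lies in the core but is never
  visited as its own neighbour.\<close>

definition count_core :: com where
  "count_core = Seq (Assign vCore (Num 1)) (for_neighbours core_step)"

text \<open>All removable vertices with the same closed neighbourhood overwrite each other's labels
  completely, so two vertices get equal nonzero labels iff they are deleted as parts of one clique.\<close>

definition piece_step :: com where
  "piece_step = Put aPiece (Var vU) (Add (Var vV) (Num 1))"

definition make_piece :: com where
  "make_piece = Seq (Put aPiece (Var vV) (Add (Var vV) (Num 1))) (for_neighbours piece_step)"

definition process_vertex :: com where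
  "process_vertex = Seq mark (Seq classify (Seq count_core
     (If (Conj (Equal (Var vInner) (Var vTri)) (Less (Var vCut) (Var vCore))) make_piece Skip)))"

definition find_pieces :: com where
  "find_pieces = Seq (Assign vV (Num 0))
     (While (Less (Var vV) (Var vN)) (Seq process_vertex (incr vV)))"

context edge_list
begin

section \<open>Analysis of the loop over the vertices\<close>

lemma finite_E: "finite E"
  using simple_graphD(2)[OF graph] .

lemma finite_nbh: "finite (nbh E v)"
proof -
  have "nbh E v \<subseteq> insert v {..<n}" using simple_graph_edge(3)[OF graph] by (auto simp: nbh_def)
  then show ?thesis by (rule finite_subset) simp
qed

definition at_vertex :: "nat \<Rightarrow> (nat \<Rightarrow> nat) \<Rightarrow> state \<Rightarrow> bool" where
  "at_vertex v p s \<longleftrightarrow> holds_input s \<and> vars s vV = v \<and> arrs s aPiece = p"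

text \<open>Guarantees that no entry equals the stamp \<open>v + 1\<close> yet, so nothing counts as
  marked or flagged when \<open>v\<close> is begun.\<close>

definition stamps_le :: "nat \<Rightarrow> state \<Rightarrow> bool" where
  "stamps_le v s \<longleftrightarrow> (\<forall>x. arrs s aMark x \<le> v) \<and> (\<forall>x. arrs s aFlag x \<le> v)"

lemma reach_mark:
  assumes "at_vertex v p s" "stamps_le v s"
  shows "reach mark s (neighbours_cost (card E) mark_step + 9)
    (\<lambda>s. at_vertex v p s \<and> (\<forall>x. arrs s aMark x \<le> Suc v) \<and> (\<forall>x. arrs s aFlag x \<le> v) \<and>
      (\<forall>x. arrs s aMark x = Suc v \<longleftrightarrow> x \<in> nbh E v) \<and>
      2 * vars s vTri = card (nbh E v) * (card (nbh E v) - 1))"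
proof -
  \<comment> \<open>The visited set contains \<open>v\<close> itself, hence the \<open>Suc\<close>.
    The triangular number is stated doubled, to match \<open>clique_iff_card\<close>.\<close>
  define I where "I M s \<longleftrightarrow> arrs s aPiece = p \<and> (\<forall>x. arrs s aMark x \<le> Suc v) \<and> (\<forall>x. arrs s aFlag x \<le> v) \<and>
      (\<forall>x. arrs s aMark x = Suc v \<longleftrightarrow> x \<in> M) \<and> Suc (vars s vDeg) = card M \<and>
      2 * vars s vTri = vars s vDeg * Suc (vars s vDeg)"
    for M and s :: state
  let ?init = "Seq (Put aMark (Var vV) (Add (Var vV) (Num 1))) (Seq (Assign vDeg (Num 0)) (Assign vTri (Num 0)))"
  have "reach (for_neighbours mark_step) (result ?init s) (neighbours_cost (card E) mark_step)
    (\<lambda>s. holds_input s \<and> vars s vV = v \<and> I (nbh E v) s)"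
  proof (rule reach_for_neighbours)
    show "loop_free mark_step" by (simp add: mark_step_def incr_def)
    fix M s assume M: "M \<subseteq> nbh E v" "vars s vU \<notin> M" and h: "holds_input s" "vars s vV = v" and I: "I M s"
    have "finite M" using M(1) finite_nbh by (rule finite_subset)
    then have c: "card (insert (vars s vU) M) = Suc (card M)" using M(2) by simp
    have cM: "card M = Suc (vars s vDeg)" using I by (simp add: I_def)
    show "holds_input (result mark_step s) \<and> vars (result mark_step s) vV = v \<and>
        vars (result mark_step s) vI = vars s vI \<and> I (insert (vars s vU) M) (result mark_step s)"
      using h I unfolding I_def c cM by (simp add: mark_step_def incr_def holds_input_def)
  next
    have "arrs s aMark x \<le> v" "arrs s aFlag x \<le> v" for x
      using assms(2) by (simp_all add: stamps_le_def)
    then have "arrs s aMark x \<le> Suc v" "arrs s aMark x \<noteq> Suc v" "arrs s aFlag x \<le> v" for x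
      by (simp_all add: le_SucI less_imp_neq less_Suc_eq_le)
    then show "I {v} (result ?init s)"
      using assms(1) unfolding I_def by (simp add: at_vertex_def)
  qed (use assms in \<open>auto simp: I_def at_vertex_def holds_input_def\<close>)
  then have "reach (Seq ?init (for_neighbours mark_step)) s (cost ?init + neighbours_cost (card E) mark_step)
     (\<lambda>s. holds_input s \<and> vars s vV = v \<and> I (nbh E v) s)"
    by (intro reach_Seq_loop_free) simp_all
  then show ?thesis
    unfolding mark_def
  proof (rule reach_mono)
    fix s assume s: "holds_input s \<and> vars s vV = v \<and> I (nbh E v) s"
    then have "card (nbh E v) = Suc (vars s vDeg)" by (simp add: I_def)
    then show "at_vertex v p s \<and> (\<forall>x. arrs s aMark x \<le> Suc v) \<and> (\<forall>x. arrs s aFlag x \<le> v) \<and>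
      (\<forall>x. arrs s aMark x = Suc v \<longleftrightarrow> x \<in> nbh E v) \<and>
      2 * vars s vTri = card (nbh E v) * (card (nbh E v) - 1)"
      using s by (simp add: I_def at_vertex_def)
  qed simp
qed

text \<open>Each cut edge flags its endpoint inside \<open>X\<close>, and the core is by definition
  what stays unflagged.\<close>

lemma reach_classify:
  assumes v: "at_vertex v p s" and m: "\<And>x. arrs s aMark x \<le> Suc v" "\<And>x. arrs s aFlag x \<le> v"
    "\<And>x. arrs s aMark x = Suc v \<longleftrightarrow> x \<in> X"
  shows "reach classify s (edges_cost (card E) classify_step + 4)
    (\<lambda>s'. at_vertex v p s' \<and> stamps_le (Suc v) s' \<and> vars s' vTri = vars s vTri \<and>
      (\<forall>x. arrs s' aFlag x = Suc v \<longleftrightarrow> x \<in> X - core E X) \<and>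
      vars s' vInner = card {e \<in> E. e \<subseteq> X} \<and> vars s' vCut = card (cut_edges E X))"
proof -
  define I where "I F s' \<longleftrightarrow> vars s' vV = v \<and> vars s' vTri = vars s vTri \<and>
      arrs s' aPiece = p \<and> arrs s' aMark = arrs s aMark \<and> (\<forall>x. arrs s' aFlag x \<le> Suc v) \<and>
      (\<forall>x. arrs s' aFlag x = Suc v \<longleftrightarrow> x \<in> X \<inter> \<Union> (cut_edges F X)) \<and>
      vars s' vInner = card {e \<in> F. e \<subseteq> X} \<and> vars s' vCut = card (cut_edges F X)" for F and s' :: state
  let ?init = "Seq (Assign vInner (Num 0)) (Assign vCut (Num 0))"
  have "reach (for_edges classify_step) (result ?init s) (edges_cost (card E) classify_step)
    (\<lambda>s. holds_input s \<and> I E s)"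
  proof (rule reach_for_edges)
    show "loop_free classify_step" by (simp add: classify_step_def incr_def)
    fix F and s' :: state let ?x = "vars s' vX" and ?y = "vars s' vY"
    let ?F = "insert {?x, ?y} F"
    assume F: "F \<subseteq> E" and e: "{?x, ?y} \<in> E - F" and h: "holds_input s'" and I: "I F s'"
    have fin: "finite F" using F finite_E by (rule finite_subset)
    have ncut: "{?x, ?y} \<notin> cut_edges F X" using e by (simp add: cut_edges_def)
    have mk: "bval (marked z) s' \<longleftrightarrow> vars s' z \<in> X" for z
      using I m(3) by (simp add: I_def marked_def)
    have "I ?F (result classify_step s') \<and> holds_input (result classify_step s') \<and>
      vars (result classify_step s') vI = vars s' vI"
    proof -
      consider "?x \<in> X" "?y \<in> X" | "?x \<in> X" "?y \<notin> X" | "?x \<notin> X" "?y \<in> X" | "?x \<notin> X" "?y \<notin> X"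
        by blast
      then show ?thesis
      proof cases
        case 1
        then have "cut_edges ?F X = cut_edges F X" "{e \<in> ?F. e \<subseteq> X} = insert {?x, ?y} {e \<in> F. e \<subseteq> X}"
          by (auto simp: cut_edges_def)
        moreover have "card (insert {?x, ?y} {e \<in> F. e \<subseteq> X}) = Suc (card {e \<in> F. e \<subseteq> X})"
          using fin e by (intro card_insert_disjoint) auto
        ultimately show ?thesis using h I 1
          by (simp add: classify_step_def mk incr_def I_def holds_input_def)
      next
        case 2
        then have "cut_edges ?F X = insert {?x, ?y} (cut_edges F X)" "{e \<in> ?F. e \<subseteq> X} = {e \<in> F. e \<subseteq> X}"
          by (auto simp: cut_edges_def)
        moreover have "card (insert {?x, ?y} (cut_edges F X)) = Suc (card (cut_edges F X))"
          using fin ncut by (intro card_insert_disjoint) (auto simp: cut_edges_def)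
        ultimately show ?thesis using h I 2
          by (auto simp: classify_step_def mk incr_def I_def holds_input_def)
      next
        case 3
        then have "cut_edges ?F X = insert {?x, ?y} (cut_edges F X)" "{e \<in> ?F. e \<subseteq> X} = {e \<in> F. e \<subseteq> X}"
          by (auto simp: cut_edges_def)
        moreover have "card (insert {?x, ?y} (cut_edges F X)) = Suc (card (cut_edges F X))"
          using fin ncut by (intro card_insert_disjoint) (auto simp: cut_edges_def)
        ultimately show ?thesis using h I 3
          by (auto simp: classify_step_def mk incr_def I_def holds_input_def)
      next
        case 4
        then have "cut_edges ?F X = cut_edges F X" "{e \<in> ?F. e \<subseteq> X} = {e \<in> F. e \<subseteq> X}"
          by (auto simp: cut_edges_def)
        then show ?thesis using h I 4
          by (simp add: classify_step_def mk incr_def I_def holds_input_def)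
      qed
    qed
    then show "holds_input (result classify_step s') \<and>
      vars (result classify_step s') vI = vars s' vI \<and> I ?F (result classify_step s')" by blast
  next
    have "arrs s aFlag x \<noteq> Suc v" "arrs s aFlag x \<le> Suc v" for x
      using m(2)[of x] by auto
    then show "I {} (result ?init s)"
      using v unfolding I_def by (simp add: at_vertex_def cut_edges_def)
  qed (use v in \<open>auto simp: I_def at_vertex_def holds_input_def\<close>)
  then have "reach (Seq ?init (for_edges classify_step)) s (cost ?init + edges_cost (card E) classify_step)
     (\<lambda>s. holds_input s \<and> I E s)"
    by (intro reach_Seq_loop_free) simp_all
  then show ?thesis
    unfolding classify_def
  proof (rule reach_mono)
    fix s' assume s: "holds_input s' \<and> I E s'"
    have "x \<in> X - core E X \<longleftrightarrow> x \<in> X \<inter> \<Union> (cut_edges E X)" for x by (auto simp: core_def)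
    then show "at_vertex v p s' \<and> stamps_le (Suc v) s' \<and> vars s' vTri = vars s vTri \<and>
      (\<forall>x. arrs s' aFlag x = Suc v \<longleftrightarrow> x \<in> X - core E X) \<and>
      vars s' vInner = card {e \<in> E. e \<subseteq> X} \<and> vars s' vCut = card (cut_edges E X)"
      using s m(1) by (simp add: I_def at_vertex_def stamps_le_def)
  qed simp
qed

lemma reach_count_core:
  assumes v: "at_vertex v p s" and m: "stamps_le (Suc v) s"
    "\<And>x. arrs s aFlag x = Suc v \<longleftrightarrow> x \<in> nbh E v - core E (nbh E v)"
  shows "reach count_core s (neighbours_cost (card E) core_step + 2)
    (\<lambda>s'. at_vertex v p s' \<and> stamps_le (Suc v) s' \<and> vars s' vTri = vars s vTri \<and>
      vars s' vInner = vars s vInner \<and> vars s' vCut = vars s vCut \<and>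
      vars s' vCore = card (core E (nbh E v)))"
proof -
  let ?K = "core E (nbh E v)"
  define I where "I M s' \<longleftrightarrow> arrs s' = arrs s \<and> vars s' vTri = vars s vTri \<and>
      vars s' vInner = vars s vInner \<and> vars s' vCut = vars s vCut \<and> vars s' vCore = card (M \<inter> ?K)"
    for M and s' :: state
  let ?init = "Assign vCore (Num 1)"
  have "reach (for_neighbours core_step) (result ?init s) (neighbours_cost (card E) core_step)
    (\<lambda>s. holds_input s \<and> vars s vV = v \<and> I (nbh E v) s)"
  proof (rule reach_for_neighbours)
    show "loop_free core_step" by (simp add: core_step_def incr_def)
    fix M and s' :: state let ?u = "vars s' vU"
    assume M: "M \<subseteq> nbh E v" "?u \<notin> M" and e: "{v, ?u} \<in> E"
      and h: "holds_input s'" "vars s' vV = v" and I: "I M s'"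
    have "finite M" using M(1) finite_nbh by (rule finite_subset)
    moreover have "?u \<in> nbh E v" using e by (simp add: nbh_def)
    ultimately show "holds_input (result core_step s') \<and> vars (result core_step s') vV = v \<and>
        vars (result core_step s') vI = vars s' vI \<and> I (insert ?u M) (result core_step s')"
      using h I M(2) m(2)[of ?u] unfolding I_def
      by (simp add: core_step_def incr_def holds_input_def)
  next
    show "I {v} (result ?init s)"
      using self_in_core[OF graph, of v] unfolding I_def by simp
  qed (use v in \<open>auto simp: I_def at_vertex_def holds_input_def\<close>)
  then have "reach (Seq ?init (for_neighbours core_step)) s (cost ?init + neighbours_cost (card E) core_step)
     (\<lambda>s. holds_input s \<and> vars s vV = v \<and> I (nbh E v) s)"
    by (intro reach_Seq_loop_free) simp_all
  then show ?thesis
    unfolding count_core_def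
  proof (rule reach_mono)
    fix s' assume s: "holds_input s' \<and> vars s' vV = v \<and> I (nbh E v) s'"
    have "nbh E v \<inter> ?K = ?K" by (auto simp: core_def)
    then show "at_vertex v p s' \<and> stamps_le (Suc v) s' \<and> vars s' vTri = vars s vTri \<and>
      vars s' vInner = vars s vInner \<and> vars s' vCut = vars s vCut \<and> vars s' vCore = card ?K"
      using s v m(1) by (simp add: I_def at_vertex_def stamps_le_def)
  qed simp
qed

lemma reach_make_piece:
  assumes v: "at_vertex v p s" and m: "stamps_le (Suc v) s"
  shows "reach make_piece s (neighbours_cost (card E) piece_step + 5)
    (\<lambda>s. at_vertex v (\<lambda>x. if x \<in> nbh E v then Suc v else p x) s \<and> stamps_le (Suc v) s)"
proof -
  define I where "I M s \<longleftrightarrow> arrs s aPiece = (\<lambda>x. if x \<in> M then Suc v else p x) \<and> stamps_le (Suc v) s"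
    for M and s :: state
  let ?init = "Put aPiece (Var vV) (Add (Var vV) (Num 1))"
  have "reach (for_neighbours piece_step) (result ?init s) (neighbours_cost (card E) piece_step)
    (\<lambda>s. holds_input s \<and> vars s vV = v \<and> I (nbh E v) s)"
  proof (rule reach_for_neighbours)
    show "loop_free piece_step" by (simp add: piece_step_def)
    fix M and s' :: state let ?u = "vars s' vU"
    assume h: "holds_input s'" "vars s' vV = v" and I: "I M s'"
    then show "holds_input (result piece_step s') \<and> vars (result piece_step s') vV = v \<and>
        vars (result piece_step s') vI = vars s' vI \<and> I (insert ?u M) (result piece_step s')"
      unfolding I_def by (auto simp: piece_step_def holds_input_def stamps_le_def)
  next
    show "I {v} (result ?init s)"
      using v m unfolding I_def by (auto simp: at_vertex_def stamps_le_def)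
  qed (use v in \<open>auto simp: I_def at_vertex_def holds_input_def stamps_le_def\<close>)
  then have "reach (Seq ?init (for_neighbours piece_step)) s (cost ?init + neighbours_cost (card E) piece_step)
     (\<lambda>s. holds_input s \<and> vars s vV = v \<and> I (nbh E v) s)"
    by (intro reach_Seq_loop_free) simp_all
  then show ?thesis
    unfolding make_piece_def by (rule reach_mono) (auto simp: I_def at_vertex_def)
qed

text \<open>A nonzero label minus one is a vertex whose closed neighbourhood is the piece; the shift
  reserves 0 for vertices that stay. The first clause makes labels trustworthy, the second makes
  each piece found so far fully and uniformly labelled.\<close>

definition labels_upto :: "nat \<Rightarrow> (nat \<Rightarrow> nat) \<Rightarrow> bool" where
  "labels_upto v p \<longleftrightarrow>
     (\<forall>x. p x \<noteq> 0 \<longrightarrow> p x \<le> v \<and> removable E (p x - 1) \<and> x \<in> nbh E (p x - 1)) \<and>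
     (\<forall>u<v. removable E u \<longrightarrow> (\<forall>x\<in>nbh E u. \<forall>y\<in>nbh E u. p x \<noteq> 0 \<and> p x = p y))"

text \<open>By disjointness, the neighbourhood of \<open>v\<close> either coincides with an earlier
  piece, which is relabelled as a whole, or meets none of them.\<close>

lemma labels_upto_Suc:
  assumes p: "labels_upto v p"
  shows "labels_upto (Suc v) (if removable E v then \<lambda>x. if x \<in> nbh E v then Suc v else p x else p)"
proof -
  have D1: "p x \<le> v \<and> removable E (p x - 1) \<and> x \<in> nbh E (p x - 1)" if "p x \<noteq> 0" for x
    using p that unfolding labels_upto_def by blast
  have D2: "p x \<noteq> 0 \<and> p x = p y" if "u < v" "removable E u" "x \<in> nbh E u" "y \<in> nbh E u" for u x y
    using p that unfolding labels_upto_def by blast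
  show ?thesis
  proof (cases "removable E v")
    case True
    let ?p = "\<lambda>x. if x \<in> nbh E v then Suc v else p x"
    have "?p x \<noteq> 0 \<and> ?p x = ?p y"
      if u: "u < Suc v" "removable E u" and xy: "x \<in> nbh E u" "y \<in> nbh E u" for u x y
    proof (cases "nbh E u = nbh E v")
      case False
      then have "nbh E u \<inter> nbh E v = {}" using removable_nbh_disjoint[OF graph u(2) True] by simp
      then have "x \<notin> nbh E v" "y \<notin> nbh E v" using xy by blast+
      moreover have "u < v" using False u(1) by (metis less_antisym)
      ultimately show ?thesis using D2[OF _ u(2) xy] by simp
    qed (use xy in simp)
    moreover have "?p x \<le> Suc v \<and> removable E (?p x - 1) \<and> x \<in> nbh E (?p x - 1)" if "?p x \<noteq> 0" for x
    proof (cases "x \<in> nbh E v")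
      case False
      then show ?thesis using D1[of x] that by simp
    qed (use True in simp)
    ultimately have "labels_upto (Suc v) ?p" unfolding labels_upto_def by blast
    then show ?thesis using True by simp
  next
    case False
    have "p x \<le> Suc v \<and> removable E (p x - 1) \<and> x \<in> nbh E (p x - 1)" if "p x \<noteq> 0" for x
      using D1[OF that] by simp
    moreover have "u < v" if "u < Suc v" "removable E u" for u
      using that False by (metis less_antisym)
    ultimately have "labels_upto (Suc v) p" using D2 unfolding labels_upto_def by blast
    then show ?thesis using False by simp
  qed
qed

text \<open>The 20 is rounded up from 13: the set-up of \<open>make_piece\<close> and the test that
  guards it.\<close>

definition vertex_cost :: nat where
  "vertex_cost = neighbours_cost (card E) mark_step + 9 + (edges_cost (card E) classify_step + 4 +
     (neighbours_cost (card E) core_step + 2 + (neighbours_cost (card E) piece_step + 20)))"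

lemma reach_process_vertex:
  assumes "at_vertex v p s" "stamps_le v s" "labels_upto v p"
  shows "reach process_vertex s vertex_cost
    (\<lambda>s. \<exists>p. at_vertex v p s \<and> stamps_le (Suc v) s \<and> labels_upto (Suc v) p)"
  unfolding process_vertex_def vertex_cost_def
proof (intro reach_Seq reach_mono[OF reach_mark[OF assms(1,2)]])
  let ?X = "nbh E v"
  let ?b = "Conj (Equal (Var vInner) (Var vTri)) (Less (Var vCut) (Var vCore))"
  let ?Q = "\<lambda>s. \<exists>p. at_vertex v p s \<and> stamps_le (Suc v) s \<and> labels_upto (Suc v) p"
  fix s1
  assume 1: "at_vertex v p s1 \<and> (\<forall>x. arrs s1 aMark x \<le> Suc v) \<and> (\<forall>x. arrs s1 aFlag x \<le> v) \<and>
      (\<forall>x. arrs s1 aMark x = Suc v \<longleftrightarrow> x \<in> ?X) \<and> 2 * vars s1 vTri = card ?X * (card ?X - 1)"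
  show "reach classify s1 (edges_cost (card E) classify_step + 4)
     (\<lambda>s. reach (Seq count_core (If ?b make_piece Skip)) s
       (neighbours_cost (card E) core_step + 2 + (neighbours_cost (card E) piece_step + 20)) ?Q)"
  proof (rule reach_mono[OF reach_classify[of v p s1 ?X]])
    fix s2
    assume 2: "at_vertex v p s2 \<and> stamps_le (Suc v) s2 \<and> vars s2 vTri = vars s1 vTri \<and>
      (\<forall>x. arrs s2 aFlag x = Suc v \<longleftrightarrow> x \<in> ?X - core E ?X) \<and>
      vars s2 vInner = card {e \<in> E. e \<subseteq> ?X} \<and> vars s2 vCut = card (cut_edges E ?X)"
    show "reach (Seq count_core (If ?b make_piece Skip)) s2
       (neighbours_cost (card E) core_step + 2 + (neighbours_cost (card E) piece_step + 20)) ?Q"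
    proof (rule reach_Seq, rule reach_mono[OF reach_count_core[of v p s2]])
      fix s3
      assume 3: "at_vertex v p s3 \<and> stamps_le (Suc v) s3 \<and> vars s3 vTri = vars s2 vTri \<and>
        vars s3 vInner = vars s2 vInner \<and> vars s3 vCut = vars s2 vCut \<and>
        vars s3 vCore = card (core E ?X)"
      \<comment> \<open>Both \<open>vTri\<close> and the count in \<open>clique_iff_card\<close> are
        known through their doubles, so equality of \<open>vInner\<close> and \<open>vTri\<close> is
        the clique test.\<close>
      have b: "bval ?b s3 \<longleftrightarrow> removable E v"
        using 1 2 3 clique_iff_card[OF graph finite_nbh[of v]] by (auto simp: removable_def)
      have "reach (If ?b make_piece Skip) s3 (bcost ?b + (neighbours_cost (card E) piece_step + 5) + 1) ?Q"
      proof (rule reach_If)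
        assume "bval ?b s3"
        then have "removable E v" using b by blast
        then have "labels_upto (Suc v) (\<lambda>x. if x \<in> ?X then Suc v else p x)"
          using labels_upto_Suc[OF assms(3)] by simp
        then show "reach make_piece s3 (neighbours_cost (card E) piece_step + 5) ?Q"
          using 3 by (intro reach_mono[OF reach_make_piece[of v p s3]]) blast+
      next
        assume "\<not> bval ?b s3"
        then have "\<not> removable E v" using b by blast
        then have "labels_upto (Suc v) p" using labels_upto_Suc[OF assms(3)] by simp
        then have "reach Skip s3 (cost Skip) ?Q"
          using 3 by (intro reach_loop_free) auto
        then show "reach Skip s3 (neighbours_cost (card E) piece_step + 5) ?Q"
          by (rule reach_mono) simp_all
      qed
      then show "reach (If ?b make_piece Skip) s3 (neighbours_cost (card E) piece_step + 20) ?Q"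
        by (rule reach_mono) simp_all
    qed (use 2 in auto)
  qed (use 1 in auto)
qed simp_all

lemma reach_find_pieces:
  assumes "holds_input s" "arrs s aPiece = (\<lambda>_. 0)" "stamps_le 0 s"
  shows "reach find_pieces s (n * (vertex_cost + 8) + 6)
    (\<lambda>s. holds_input s \<and> labels_upto n (arrs s aPiece))"
proof -
  let ?I = "\<lambda>v s. \<exists>p. at_vertex v p s \<and> stamps_le v s \<and> labels_upto v p"
  have "reach (While (Less (Var vV) (Var vN)) (Seq process_vertex (incr vV))) (result (Assign vV (Num 0)) s)
    (n * (bcost (Less (Var vV) (Var vN)) + (vertex_cost + 4) + 1) + bcost (Less (Var vV) (Var vN)) + 1) (?I n)"
  proof (rule reach_While[where I = ?I])
    fix v s assume "?I v s"
    then obtain p where p: "at_vertex v p s" "stamps_le v s" "labels_upto v p" by blast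
    show "reach (Seq process_vertex (incr vV)) s (vertex_cost + 4) (?I (Suc v))"
    proof (intro reach_Seq reach_mono[OF reach_process_vertex[OF p] order_refl])
      fix s assume "\<exists>p. at_vertex v p s \<and> stamps_le (Suc v) s \<and> labels_upto (Suc v) p"
      then have "?I (Suc v) (result (incr vV) s)"
        by (auto simp: incr_def at_vertex_def holds_input_def stamps_le_def)
      then have "reach (incr vV) s (cost (incr vV)) (?I (Suc v))"
        using reach_loop_free[of "incr vV" "?I (Suc v)"] by (simp add: incr_def)
      then show "reach (incr vV) s 4 (?I (Suc v))" by (rule reach_mono) (simp_all add: incr_def)
    qed
  next
    have "labels_upto 0 (\<lambda>_. 0)" by (simp add: labels_upto_def)
    then show "?I 0 (result (Assign vV (Num 0)) s)"
      using assms by (auto simp: at_vertex_def holds_input_def stamps_le_def)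
  qed (auto simp: at_vertex_def holds_input_def)
  then have "reach (Seq (Assign vV (Num 0)) (While (Less (Var vV) (Var vN)) (Seq process_vertex (incr vV)))) s
    (cost (Assign vV (Num 0)) + (n * (bcost (Less (Var vV) (Var vN)) + (vertex_cost + 4) + 1) + bcost (Less (Var vV) (Var vN)) + 1)) (?I n)"
    by (intro reach_Seq_loop_free) simp_all
  then show ?thesis
    unfolding find_pieces_def by (rule reach_mono) (auto simp: at_vertex_def)
qed

end

section \<open>Assembling the reduced instance\<close>

definition cross_step :: com where
  "cross_step = If (Equal (Get aPiece (Var vX)) (Get aPiece (Var vY))) Skip (incr vCross)"

definition count_crossing :: com where
  "count_crossing = Seq (Assign vCross (Num 0)) (for_edges cross_step)"

definition number_step :: com where
  "number_step = Seq
     (If (Equal (Get aPiece (Var vV)) (Num 0)) (Seq (Put aIndex (Var vV) (Var vN')) (incr vN')) Skip)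
     (incr vV)"

definition renumber :: com where
  "renumber = Seq (Seq (Assign vN' (Num 0)) (Assign vV (Num 0)))
     (While (Less (Var vV) (Var vN)) number_step)"

text \<open>The new edges go to separate arrays because \<open>reach_for_edges\<close> requires the
  edge list to stay intact during the scan.\<close>

definition collect_step :: com where
  "collect_step = If
     (Conj (Equal (Get aPiece (Var vX)) (Num 0)) (Equal (Get aPiece (Var vY)) (Num 0)))
     (Seq (Put aFst (Var vM') (Get aIndex (Var vX)))
       (Seq (Put aSnd (Var vM') (Get aIndex (Var vY))) (incr vM')))
     Skip"

definition collect :: com where
  "collect = Seq (Assign vM' (Num 0)) (for_edges collect_step)"

definition copy_step :: com where
  "copy_step = Seq (Put 0 (Var vI) (Get aFst (Var vI)))
     (Seq (Put 1 (Var vI) (Get aSnd (Var vI))) (incr vI))"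

definition copy_edges :: com where
  "copy_edges = Seq (Assign vI (Num 0)) (While (Less (Var vI) (Var vM')) copy_step)"

definition set_counts :: com where
  "set_counts = Seq (Assign vN (Var vN')) (Seq (Assign vM (Var vM'))
     (Assign vK (Sub (Var vK) (Var vCross))))"

text \<open>The path of \<open>path_imp_no\<close> with parameter 0; its three vertices respect the
  bound \<open>4 * k\<close> for every positive \<open>k\<close>.\<close>

definition no_instance :: com where
  "no_instance = Seq (Seq (Put 0 (Num 0) (Num 0)) (Seq (Put 1 (Num 0) (Num 1))
     (Seq (Put 0 (Num 1) (Num 1)) (Put 1 (Num 1) (Num 2)))))
     (Seq (Assign vN (Num 3)) (Seq (Assign vM (Num 2)) (Assign vK (Num 0))))"

text \<open>Failure of either comparison certifies a no-instance, by
  \<open>stc_yes_iff\<close>.\<close>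

definition small :: bexp where
  "small = Conj (Neg (Less (Var vK) (Var vCross)))
     (Neg (Less (Add (Add (Var vK) (Var vK)) (Add (Var vK) (Var vK))) (Var vN')))"

text \<open>An edgeless graph is a yes-instance and is replaced by the empty one at once, since even
  a single pass over its vertices would exceed the time bound.\<close>

definition kernel :: com where
  "kernel = If (Equal (Var vM) (Num 0)) (Assign vN (Num 0))
     (Seq find_pieces (Seq count_crossing (Seq renumber
       (If small (Seq collect (Seq copy_edges set_counts)) no_instance))))"

section \<open>Correctness and running time\<close>

text \<open>The form in which a function update, that is, one more array entry, extends an
  enumeration by one element.\<close>

lemma bij_betw_insert:
  assumes f: "bij_betw f A B" and new: "x \<notin> A" "g x \<notin> B" and eq: "\<And>y. y \<in> A \<Longrightarrow> g y = f y"
  shows "bij_betw g (insert x A) (insert (g x) B)"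
proof -
  have "bij_betw g A B" using f eq bij_betw_cong[of A g f B] by simp
  then show ?thesis using notIn_Un_bij_betw[of x A g B] new by simp
qed

lemma simple_graph_remaining:
  assumes G: "simple_graph V E"
  shows "simple_graph (V - \<Union> (pieces V E)) (remaining V E)"
  unfolding simple_graph_def
proof
  show "finite (V - \<Union> (pieces V E))" using simple_graphD(1)[OF G] by simp
  show "remaining V E \<subseteq> {{u, v} |u v. u \<in> (V - \<Union> (pieces V E)) \<and> v \<in> (V - \<Union> (pieces V E)) \<and> u \<noteq> v}"
  proof
    fix e assume e: "e \<in> remaining V E"
    then obtain u v where uv: "e = {u, v}" "u \<in> V" "v \<in> V" "u \<noteq> v"
      using G unfolding remaining_def simple_graph_def by blast
    then have "u \<in> (V - \<Union> (pieces V E))" "v \<in> (V - \<Union> (pieces V E))" using e by (auto simp: remaining_def)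
    then show "e \<in> {{u, v} |u v. u \<in> (V - \<Union> (pieces V E)) \<and> v \<in> (V - \<Union> (pieces V E)) \<and> u \<noteq> v}" using uv by blast
  qed
qed

text \<open>The size condition follows from being a yes-instance, by
  \<open>remaining_vertices_le\<close>. Having it inside the equivalence justifies answering no when
  it fails; the condition on the crossing edges guards the truncated subtraction.\<close>

lemma stc_yes_iff:
  assumes G: "simple_graph V E" and f: "bij_betw f (V - \<Union> (pieces V E)) V'"
  shows "strong_triadic_closure V E k \<longleftrightarrow>
    card (crossing V E) \<le> k \<and> card V' \<le> 4 * k \<and>
    strong_triadic_closure V' ((`) f ` remaining V E) (k - card (crossing V E))"
    (is "?yes \<longleftrightarrow> ?c \<le> k \<and> _ \<and> ?yes'")
proof -
  let ?U = "V - \<Union> (pieces V E)"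
  have inj: "inj_on f ?U" and im: "f ` ?U = V'" using f by (auto simp: bij_betw_def)
  note R = simple_graph_remaining[OF G]
  have "?yes' \<longleftrightarrow> strong_triadic_closure ?U (remaining V E) (k - ?c)"
    using strong_triadic_closure_image[OF inj R] im by simp
  then have yes': "?yes' \<longleftrightarrow> (\<exists>S W. stc_labeling (remaining V E) S W \<and> card W \<le> k - ?c)"
    using R by (simp add: strong_triadic_closure_def)
  have yes: "?yes \<longleftrightarrow> (\<exists>S W. stc_labeling (remaining V E) S W \<and> card W + ?c \<le> k)"
    using G stc_labeling_reduce[OF G] by (simp add: strong_triadic_closure_def)
  have "card V' \<le> 4 * k" if y: ?yes
  proof -
    obtain S W where "stc_labeling E S W" "card W \<le> k"
      using y by (auto simp: strong_triadic_closure_def)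
    then have "card ?U \<le> 4 * k" using remaining_vertices_le[OF G] by (meson mult_le_mono2 order_trans)
    then show ?thesis using bij_betw_same_card[OF f] by simp
  qed
  moreover have "?yes \<longleftrightarrow> ?c \<le> k \<and> ?yes'"
  proof (cases "?c \<le> k")
    case True
    then have "a + ?c \<le> k \<longleftrightarrow> a \<le> k - ?c" for a by linarith
    then show ?thesis using True yes yes' by simp
  next
    case False
    then show ?thesis using yes by auto
  qed
  ultimately show ?thesis by blast
qed

context edge_list
begin

abbreviation "P \<equiv> pieces {..<n} E"
abbreviation "R \<equiv> remaining {..<n} E"
abbreviation "C \<equiv> crossing {..<n} E"

section \<open>Reading pieces and crossing edges off the labels\<close>

lemma labels_removable:
  assumes p: "labels_upto n p" and x: "p x \<noteq> 0"
  shows "p x - 1 < n" "removable E (p x - 1)" "x \<in> nbh E (p x - 1)" "nbh E (p x - 1) \<in> P"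
proof -
  have "p x \<le> n" "removable E (p x - 1)" "x \<in> nbh E (p x - 1)"
    using p x unfolding labels_upto_def by blast+
  then show "p x - 1 < n" "removable E (p x - 1)" "x \<in> nbh E (p x - 1)" "nbh E (p x - 1) \<in> P"
    using x by (auto simp: pieces_def)
qed

lemma labels_eq:
  assumes "labels_upto n p" "X \<in> P" "x \<in> X" "y \<in> X"
  shows "p x \<noteq> 0" "p x = p y"
proof -
  obtain u where u: "u < n" "removable E u" "X = nbh E u" using assms(2) by (auto simp: pieces_def)
  then have "p x \<noteq> 0 \<and> p x = p y" using assms unfolding labels_upto_def by blast
  then show "p x \<noteq> 0" "p x = p y" by blast+
qed

lemma labels_nonzero: "labels_upto n p \<Longrightarrow> p x = 0 \<longleftrightarrow> x \<notin> \<Union> P"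
  using labels_removable(3,4) labels_eq(1) by blast

lemma labels_remaining:
  assumes "labels_upto n p" "{x, y} \<in> E"
  shows "{x, y} \<in> R \<longleftrightarrow> p x = 0 \<and> p y = 0"
  using assms labels_nonzero by (simp add: remaining_def)

text \<open>Equal labels mean that both ends lie in one piece or both in none, and neither kind of
  edge crosses. If the labels differ, one of them is nonzero, and its piece contains just one end of
  the edge.\<close>

lemma labels_crossing:
  assumes p: "labels_upto n p" and e: "{x, y} \<in> E"
  shows "{x, y} \<in> C \<longleftrightarrow> p x \<noteq> p y"
proof
  assume "{x, y} \<in> C"
  then obtain X where X: "X \<in> P" "{x, y} \<in> cut_edges E X" by (auto simp: crossing_def)
  have "p x \<noteq> p y" if xy: "x \<in> X" "y \<notin> X" for x y
  proof
    assume eq: "p x = p y"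
    have nz: "p x \<noteq> 0" using labels_eq(1)[OF p X(1) xy(1) xy(1)] .
    then have Y: "nbh E (p x - 1) \<in> P" "x \<in> nbh E (p x - 1)" "y \<in> nbh E (p x - 1)"
      using labels_removable(3,4)[OF p, of x] labels_removable(3)[OF p, of y] eq by simp_all
    then have "nbh E (p x - 1) = X" using pieces_disjoint[OF graph X(1) Y(1)] xy(1) by blast
    then show False using Y(3) xy(2) by simp
  qed
  from this[of x y] this[of y x] show "p x \<noteq> p y" using X(2) by (auto simp: cut_edges_def)
next
  assume ne: "p x \<noteq> p y"
  have "{x, y} \<in> C" if e: "{x, y} \<in> E" and ne: "p x \<noteq> p y" and nz: "p x \<noteq> 0" for x y
  proof -
    have X: "x \<in> nbh E (p x - 1)" "nbh E (p x - 1) \<in> P" using labels_removable(3,4)[OF p nz] .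
    then have "y \<notin> nbh E (p x - 1)" using labels_eq(2)[OF p X(2,1)] ne by blast
    then have "{x, y} \<in> cut_edges E (nbh E (p x - 1))" using e X(1) by (simp add: cut_edges_def)
    then show ?thesis using X(2) by (auto simp: crossing_def)
  qed
  from this[OF e ne] this[of y x] show "{x, y} \<in> C"
    using e ne by (metis insert_commute)
qed

section \<open>Correctness of the output phase\<close>

lemma reach_count_crossing:
  assumes s: "holds_input s" "arrs s aPiece = p" and p: "labels_upto n p"
  shows "reach count_crossing s (edges_cost (card E) cross_step + 2)
    (\<lambda>s. holds_input s \<and> arrs s aPiece = p \<and> vars s vCross = card C)"
proof -
  define I where "I F s \<longleftrightarrow> arrs s aPiece = p \<and> vars s vCross = card (F \<inter> C)" for F and s :: state
  let ?init = "Assign vCross (Num 0)"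
  have "reach (for_edges cross_step) (result ?init s) (edges_cost (card E) cross_step)
    (\<lambda>s. holds_input s \<and> I E s)"
  proof (rule reach_for_edges)
    show "loop_free cross_step" by (simp add: cross_step_def incr_def)
    fix F and s :: state let ?e = "{vars s vX, vars s vY}"
    assume F: "F \<subseteq> E" and e: "?e \<in> E - F" and h: "holds_input s" and I: "I F s"
    have "finite F" using F finite_E by (rule finite_subset)
    then have "card (insert ?e F \<inter> C) = (if ?e \<in> C then Suc (card (F \<inter> C)) else card (F \<inter> C))"
      using e by simp
    moreover have "?e \<in> C \<longleftrightarrow> p (vars s vX) \<noteq> p (vars s vY)"
      using labels_crossing[OF p] e by blast
    ultimately show "holds_input (result cross_step s) \<and>
      vars (result cross_step s) vI = vars s vI \<and> I (insert ?e F) (result cross_step s)"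
      using h I by (simp add: cross_step_def incr_def I_def holds_input_def)
  qed (use s in \<open>auto simp: I_def holds_input_def\<close>)
  then have "reach (Seq ?init (for_edges cross_step)) s (cost ?init + edges_cost (card E) cross_step)
     (\<lambda>s. holds_input s \<and> I E s)"
    by (intro reach_Seq_loop_free) simp_all
  moreover have "E \<inter> C = C" by (auto simp: crossing_def cut_edges_def)
  ultimately show ?thesis
    unfolding count_crossing_def by (elim reach_mono) (auto simp: I_def)
qed

lemma reach_renumber:
  assumes s: "holds_input s" "arrs s aPiece = p" "vars s vCross = r" and p: "labels_upto n p"
  shows "reach renumber s (n * (cost number_step + 4) + 8)
    (\<lambda>s. holds_input s \<and> arrs s aPiece = p \<and> vars s vCross = r \<and>
      bij_betw (arrs s aIndex) ({..<n} - \<Union> P) {..<vars s vN'})"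
proof -
  let ?I = "\<lambda>v s. holds_input s \<and> arrs s aPiece = p \<and> vars s vCross = r \<and> vars s vV = v \<and>
      bij_betw (arrs s aIndex) ({..<v} - \<Union> P) {..<vars s vN'}"
  let ?init = "Seq (Assign vN' (Num 0)) (Assign vV (Num 0))"
  let ?test = "Less (Var vV) (Var vN)"
  have "reach (While ?test number_step) (result ?init s)
    (n * (bcost ?test + cost number_step + 1) + bcost ?test + 1) (?I n)"
  proof (rule reach_While[where I = ?I])
    fix v s assume I: "?I v s"
    have "?I (Suc v) (result number_step s)"
    proof (cases "p v = 0")
      case True
      then have v: "v \<notin> \<Union> P" using labels_nonzero[OF p] by simp
      let ?f = "(arrs s aIndex)(v := vars s vN')"
      have "bij_betw ?f (insert v ({..<v} - \<Union> P)) (insert (?f v) {..<vars s vN'})"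
        using I by (intro bij_betw_insert[where f = "arrs s aIndex"]) auto
      moreover have "{..<Suc v} - \<Union> P = insert v ({..<v} - \<Union> P)" using v by auto
      ultimately show ?thesis
        using I True by (simp add: number_step_def incr_def holds_input_def lessThan_Suc)
    next
      case False
      then have "{..<Suc v} - \<Union> P = {..<v} - \<Union> P"
        using labels_nonzero[OF p, of v] by (auto simp: less_Suc_eq)
      then show ?thesis
        using I False by (simp add: number_step_def incr_def holds_input_def)
    qed
    moreover have "loop_free number_step" by (simp add: number_step_def incr_def)
    ultimately show "reach number_step s (cost number_step) (?I (Suc v))"
      using reach_loop_free[where Q = "?I (Suc v)"] by blast
  next
    show "?I 0 (result ?init s)" using s by (simp add: holds_input_def bij_betw_def)
  qed (simp add: holds_input_def)
  then have "reach (Seq ?init (While ?test number_step)) s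
    (cost ?init + (n * (bcost ?test + cost number_step + 1) + bcost ?test + 1)) (?I n)"
    by (intro reach_Seq_loop_free) simp_all
  then show ?thesis
    unfolding renumber_def by (rule reach_mono) (auto simp: algebra_simps)
qed

lemma reach_collect:
  assumes s: "holds_input s" "arrs s aPiece = p" "vars s vCross = r" "vars s vN' = n'"
      "arrs s aIndex = f"
    and p: "labels_upto n p" and f: "inj_on f ({..<n} - \<Union> P)"
  shows "reach collect s (edges_cost (card E) collect_step + 2)
    (\<lambda>s. holds_input s \<and> vars s vCross = r \<and> vars s vN' = n' \<and>
      bij_betw (\<lambda>i. {arrs s aFst i, arrs s aSnd i}) {..<vars s vM'} ((`) f ` R))"
proof -
  define I where "I F s \<longleftrightarrow> arrs s aPiece = p \<and> vars s vCross = r \<and> vars s vN' = n' \<and>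
      arrs s aIndex = f \<and>
      bij_betw (\<lambda>i. {arrs s aFst i, arrs s aSnd i}) {..<vars s vM'} ((`) f ` (F \<inter> R))"
    for F and s :: state
  let ?init = "Assign vM' (Num 0)"
  have "reach (for_edges collect_step) (result ?init s) (edges_cost (card E) collect_step)
    (\<lambda>s. holds_input s \<and> I E s)"
  proof (rule reach_for_edges)
    show "loop_free collect_step" by (simp add: collect_step_def incr_def)
    fix F and s :: state let ?e = "{vars s vX, vars s vY}"
    assume F: "F \<subseteq> E" and e: "?e \<in> E - F" and h: "holds_input s" and I: "I F s"
    have eR: "?e \<in> R \<longleftrightarrow> p (vars s vX) = 0 \<and> p (vars s vY) = 0"
      using labels_remaining[OF p] e by blast
    show "holds_input (result collect_step s) \<and>
      vars (result collect_step s) vI = vars s vI \<and> I (insert ?e F) (result collect_step s)"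
    proof (cases "?e \<in> R")
      case True
      let ?j = "vars s vM'"
      let ?g = "\<lambda>i. {((arrs s aFst)(?j := f (vars s vX))) i, ((arrs s aSnd)(?j := f (vars s vY))) i}"
      have RV: "e' \<subseteq> {..<n} - \<Union> P" if "e' \<in> R" for e'
        using that simple_graphD(3)[OF graph, of e'] by (auto simp: remaining_def)
      \<comment> \<open>Renumbering is injective on the surviving vertices, so different remaining
        edges stay different and no output entry is repeated.\<close>
      have "f ` ?e \<notin> (`) f ` (F \<inter> R)"
      proof
        assume "f ` ?e \<in> (`) f ` (F \<inter> R)"
        then obtain e' where e': "f ` ?e = f ` e'" "e' \<in> F" "e' \<in> R" by blast
        then have "?e = e'" using inj_on_image_eq_iff[OF f RV[OF True] RV[OF e'(3)]] by blast
        then show False using e e'(2) by blast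
      qed
      then have "bij_betw ?g (insert ?j {..<?j}) (insert (?g ?j) ((`) f ` (F \<inter> R)))"
        using I unfolding I_def
        by (intro bij_betw_insert[where f = "\<lambda>i. {arrs s aFst i, arrs s aSnd i}"]) auto
      then have "bij_betw ?g {..<Suc ?j} ((`) f ` (insert ?e F \<inter> R))"
        using True by (simp add: lessThan_Suc)
      then show ?thesis using h I True eR
        unfolding I_def by (simp add: collect_step_def incr_def holds_input_def)
    next
      case False
      then have "insert ?e F \<inter> R = F \<inter> R" by blast
      then show ?thesis using h I False eR
        unfolding I_def by (auto simp: collect_step_def holds_input_def)
    qed
  next
    show "I {} (result ?init s)" using s by (simp add: I_def bij_betw_def)
  qed (use s in \<open>auto simp: I_def holds_input_def\<close>)
  then have "reach (Seq ?init (for_edges collect_step)) s (cost ?init + edges_cost (card E) collect_step)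
     (\<lambda>s. holds_input s \<and> I E s)"
    by (intro reach_Seq_loop_free) simp_all
  moreover have "E \<inter> R = R" by (auto simp: remaining_def)
  ultimately show ?thesis
    unfolding collect_def by (elim reach_mono) (auto simp: I_def)
qed

lemma reach_copy_edges:
  shows "reach copy_edges s (vars s vM' * (cost copy_step + 4) + 6)
    (\<lambda>s'. vars s' vK = vars s vK \<and> vars s' vCross = vars s vCross \<and> vars s' vN' = vars s vN' \<and>
      vars s' vM' = vars s vM' \<and>
      (\<forall>i<vars s vM'. arrs s' 0 i = arrs s aFst i \<and> arrs s' 1 i = arrs s aSnd i))"
proof -
  let ?I = "\<lambda>j s'. vars s' vK = vars s vK \<and> vars s' vCross = vars s vCross \<and> vars s' vN' = vars s vN' \<and>
      vars s' vM' = vars s vM' \<and> vars s' vI = j \<and> arrs s' aFst = arrs s aFst \<and> arrs s' aSnd = arrs s aSnd \<and>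
      (\<forall>i<j. arrs s' 0 i = arrs s aFst i \<and> arrs s' 1 i = arrs s aSnd i)"
  let ?test = "Less (Var vI) (Var vM')"
  have "reach (While ?test copy_step) (result (Assign vI (Num 0)) s)
    (vars s vM' * (bcost ?test + cost copy_step + 1) + bcost ?test + 1) (?I (vars s vM'))"
  proof (rule reach_While[where I = ?I])
    fix j and s' :: state assume "?I j s'"
    then have "?I (Suc j) (result copy_step s')"
      by (auto simp: copy_step_def incr_def less_Suc_eq)
    moreover have "loop_free copy_step" by (simp add: copy_step_def incr_def)
    ultimately show "reach copy_step s' (cost copy_step) (?I (Suc j))"
      using reach_loop_free[where Q = "?I (Suc j)"] by blast
  qed simp_all
  then have "reach (Seq (Assign vI (Num 0)) (While ?test copy_step)) s
    (cost (Assign vI (Num 0)) + (vars s vM' * (bcost ?test + cost copy_step + 1) + bcost ?test + 1))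
    (?I (vars s vM'))"
    by (intro reach_Seq_loop_free) simp_all
  then show ?thesis
    unfolding copy_edges_def by (rule reach_mono) (auto simp: algebra_simps)
qed

text \<open>The value 3 at \<open>k = 0\<close> is the size of the fixed no-instance.\<close>

definition is_kernel :: "state \<Rightarrow> bool" where
  "is_kernel s \<longleftrightarrow> (\<exists>n' E' k'. represents s n' E' k' \<and>
     (strong_triadic_closure {..<n} E k \<longleftrightarrow> strong_triadic_closure {..<n'} E' k') \<and>
     k' \<le> k \<and> n' \<le> (if k = 0 then 3 else 4 * k))"

lemma reach_no_instance:
  assumes "\<not> strong_triadic_closure {..<n} E k"
  shows "reach no_instance s (cost no_instance) is_kernel"
proof (rule reach_loop_free)
  let ?s = "result no_instance s" and ?E = "{{0::nat, 1}, {1, 2}}"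
  have V: "{..<3} = {0::nat, 1, 2}" by auto
  have c: "card ?E = 2" by (simp add: doubleton_eq_iff)
  have a: "arrs ?s 0 0 = 0" "arrs ?s 0 1 = 1" "arrs ?s 1 0 = 1" "arrs ?s 1 1 = 2"
    by (simp_all add: no_instance_def)
  have "bij_betw (\<lambda>i. {arrs ?s 0 i, arrs ?s 1 i}) {0, 1} ?E"
    unfolding bij_betw_def inj_on_def using a by (simp add: doubleton_eq_iff)
  moreover have "{..<2} = {0::nat, 1}" by auto
  moreover have "simple_graph {..<3} ?E"
    unfolding simple_graph_def V
  proof (intro conjI subsetI)
    fix e assume "e \<in> ?E"
    then consider "e = {0, 1}" | "e = {1, 2}" by blast
    then show "e \<in> {{u, v} |u v. u \<in> {0, 1, 2} \<and> v \<in> {0, 1, 2} \<and> u \<noteq> v}"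
    proof cases
      case 1
      moreover have "(0::nat) \<noteq> 1" by simp
      ultimately show ?thesis by blast
    next
      case 2
      moreover have "(1::nat) \<noteq> 2" by simp
      ultimately show ?thesis by blast
    qed
  qed simp
  ultimately have "represents ?s 3 ?E 0"
    unfolding represents_def c by (simp add: no_instance_def)
  moreover have "\<not> strong_triadic_closure {..<3} ?E 0"
    unfolding V by (rule path_imp_no)
  ultimately show "is_kernel ?s" using assms unfolding is_kernel_def by fastforce
qed (simp add: no_instance_def)

lemma reach_small:
  assumes s: "holds_input s" "arrs s aPiece = p" "vars s vCross = card C"
      "bij_betw (arrs s aIndex) ({..<n} - \<Union> P) {..<vars s vN'}"
    and p: "labels_upto n p"
    and c: "card C \<le> k" "vars s vN' \<le> 4 * k"
  shows "reach (Seq collect (Seq copy_edges set_counts)) s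
    (edges_cost (card E) collect_step + 2 + (card E * (cost copy_step + 4) + 6 + cost set_counts)) is_kernel"
proof (rule reach_Seq)
  let ?f = "arrs s aIndex" and ?n' = "vars s vN'" and ?U = "{..<n} - \<Union> P"
  let ?E' = "(`) ?f ` R"
  have inj: "inj_on ?f ?U" and im: "?f ` ?U = {..<?n'}" using s(4) by (auto simp: bij_betw_def)
  have iff: "strong_triadic_closure {..<n} E k \<longleftrightarrow> strong_triadic_closure {..<?n'} ?E' (k - card C)"
    using stc_yes_iff[OF graph s(4)] c by simp
  have G': "simple_graph {..<?n'} ?E'"
    using simple_graph_image[OF inj simple_graph_remaining[OF graph]] im by simp
  \<comment> \<open>The copying loop runs once per output edge; this bounds its time in terms of the
    input.\<close>
  have le: "card ?E' \<le> card E"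
    using card_image_le[of R "(`) ?f"] card_mono[of E R] finite_E finite_subset[of R E]
    by (force simp: remaining_def)
  show "reach collect s (edges_cost (card E) collect_step + 2)
    (\<lambda>s. reach (Seq copy_edges set_counts) s (card E * (cost copy_step + 4) + 6 + cost set_counts) is_kernel)"
  proof (rule reach_mono[OF reach_collect[OF s(1-3) refl refl p inj] order_refl])
    fix s1 assume 1: "holds_input s1 \<and> vars s1 vCross = card C \<and> vars s1 vN' = ?n' \<and>
      bij_betw (\<lambda>i. {arrs s1 aFst i, arrs s1 aSnd i}) {..<vars s1 vM'} ?E'"
    then have m: "vars s1 vM' = card ?E'" using bij_betw_same_card by fastforce
    show "reach (Seq copy_edges set_counts) s1 (card E * (cost copy_step + 4) + 6 + cost set_counts) is_kernel"
    proof (rule reach_Seq, rule reach_mono[OF reach_copy_edges])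
      show "vars s1 vM' * (cost copy_step + 4) + 6 \<le> card E * (cost copy_step + 4) + 6"
        using m le by simp
      fix s2 :: state assume 2: "vars s2 vK = vars s1 vK \<and> vars s2 vCross = vars s1 vCross \<and>
        vars s2 vN' = vars s1 vN' \<and> vars s2 vM' = vars s1 vM' \<and>
        (\<forall>i<vars s1 vM'. arrs s2 0 i = arrs s1 aFst i \<and> arrs s2 1 i = arrs s1 aSnd i)"
      let ?s = "result set_counts s2"
      have "bij_betw (\<lambda>i. {arrs s2 0 i, arrs s2 1 i}) {..<card ?E'} ?E'"
        using 1 2 m bij_betw_cong[of "{..<card ?E'}" "\<lambda>i. {arrs s2 0 i, arrs s2 1 i}"
          "\<lambda>i. {arrs s1 aFst i, arrs s1 aSnd i}" ?E'] by simp
      then have "represents ?s ?n' ?E' (k - card C)"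
        using G' 1 2 m by (simp add: represents_def set_counts_def holds_input_def)
      moreover have "k - card C \<le> k" "?n' \<le> (if k = 0 then 3 else 4 * k)" using c by auto
      ultimately have "is_kernel ?s" using iff unfolding is_kernel_def by blast
      then show "reach set_counts s2 (cost set_counts) is_kernel"
        by (intro reach_loop_free) (simp_all add: set_counts_def)
    qed
  qed
qed

lemma reach_pieces_kernel:
  assumes s: "holds_input s" and p: "labels_upto n (arrs s aPiece)"
  shows "reach (Seq count_crossing (Seq renumber
      (If small (Seq collect (Seq copy_edges set_counts)) no_instance))) s
    (edges_cost (card E) cross_step + 2 + (n * (cost number_step + 4) + 8 + (bcost small +
      (edges_cost (card E) collect_step + 2 + (card E * (cost copy_step + 4) + 6 + cost set_counts)
        + cost no_instance) + 1))) is_kernel"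
proof (rule reach_Seq, rule reach_mono[OF reach_count_crossing[OF s refl p]])
  let ?p = "arrs s aPiece"
  fix s1 assume 1: "holds_input s1 \<and> arrs s1 aPiece = ?p \<and> vars s1 vCross = card C"
  show "reach (Seq renumber (If small (Seq collect (Seq copy_edges set_counts)) no_instance)) s1
    (n * (cost number_step + 4) + 8 + (bcost small +
      (edges_cost (card E) collect_step + 2 + (card E * (cost copy_step + 4) + 6 + cost set_counts)
        + cost no_instance) + 1)) is_kernel"
  proof (rule reach_Seq, rule reach_mono[OF reach_renumber[of s1 ?p "card C"]])
    fix s2 assume 2: "holds_input s2 \<and> arrs s2 aPiece = ?p \<and> vars s2 vCross = card C \<and>
      bij_betw (arrs s2 aIndex) ({..<n} - \<Union> P) {..<vars s2 vN'}"
    then have b: "bval small s2 \<longleftrightarrow> card C \<le> k \<and> vars s2 vN' \<le> 4 * k"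
      by (auto simp: small_def holds_input_def)
    show "reach (If small (Seq collect (Seq copy_edges set_counts)) no_instance) s2 (bcost small +
      (edges_cost (card E) collect_step + 2 + (card E * (cost copy_step + 4) + 6 + cost set_counts)
        + cost no_instance) + 1) is_kernel"
    proof (rule reach_If)
      assume "bval small s2"
      then have "reach (Seq collect (Seq copy_edges set_counts)) s2
        (edges_cost (card E) collect_step + 2 + (card E * (cost copy_step + 4) + 6 + cost set_counts)) is_kernel"
        using 2 b p by (intro reach_small) auto
      then show "reach (Seq collect (Seq copy_edges set_counts)) s2
        (edges_cost (card E) collect_step + 2 + (card E * (cost copy_step + 4) + 6 + cost set_counts)
          + cost no_instance) is_kernel"
        by (rule reach_mono) simp_all
    next
      assume "\<not> bval small s2"
      then have "\<not> strong_triadic_closure {..<n} E k"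
        using b stc_yes_iff[OF graph, of "arrs s2 aIndex" "{..<vars s2 vN'}" k] 2 by auto
      then have "reach no_instance s2 (cost no_instance) is_kernel" by (rule reach_no_instance)
      then show "reach no_instance s2
        (edges_cost (card E) collect_step + 2 + (card E * (cost copy_step + 4) + 6 + cost set_counts)
          + cost no_instance) is_kernel"
        by (rule reach_mono) simp_all
    qed
  qed (use 1 p in auto)
qed simp

end

text \<open>The four summands are the coefficients \<open>a\<close>, \<open>b\<close>,
  \<open>c\<close>, \<open>d\<close> of \<open>bilinear_le\<close>, belonging to
  \<open>n * m\<close>, \<open>n\<close>, \<open>m\<close> and 1 in the total time bound.\<close>

definition time_factor :: nat where
  "time_factor =
     (2 * cost mark_step + 2 * cost core_step + 2 * cost piece_step + cost classify_step + 134) +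
     (cost number_step + 71) +
     (cost cross_step + cost collect_step + cost copy_step + 32) +
     (bcost small + cost set_counts + cost no_instance + 41)"

text \<open>With both counts positive, each of them is at most the product, which absorbs the
  lower-order terms.\<close>

lemma bilinear_le:
  assumes "1 \<le> n" "1 \<le> m"
  shows "n * (m * a + b) + m * c + d \<le> (a + b + c + d) * (n * m + 1 :: nat)"
proof -
  have "n \<le> n * m" "m \<le> n * m" using assms by simp_all
  then have "n * b \<le> n * m * b" "m * c \<le> n * m * c" by (simp_all only: mult_le_mono1)
  moreover have "(a + b + c + d) * (n * m + 1) = n * m * a + n * m * b + n * m * c + n * m * d + (a + b + c + d)"
    by (simp add: algebra_simps)
  moreover have "n * (m * a + b) = n * m * a + n * b" by (simp add: algebra_simps)
  ultimately show ?thesis by linarith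
qed

context edge_list
begin

lemma reach_kernel:
  assumes s: "holds_input s" "arrs s aPiece = (\<lambda>_. 0)" "stamps_le 0 s"
  shows "reach kernel s (time_factor * (n * card E + 1)) is_kernel"
proof (cases "E = {}")
  case True
  have "stc_labeling {} {} ({} :: nat set set)" by (simp add: stc_labeling_def labeling_def)
  then have yes: "strong_triadic_closure V {} k'" if "finite V" for V :: "nat set" and k'
    using that unfolding strong_triadic_closure_def simple_graph_def by force
  let ?c = "Assign vN (Num 0)"
  have "vars s vM = card E" "vars s vK = k" using s(1) unfolding holds_input_def by blast+
  then have v: "vars s vM = 0" "vars s vK = k" using True by simp_all
  then have "represents (result ?c s) 0 {} k"
    by (simp add: represents_def simple_graph_def bij_betw_def)
  moreover have "0 \<le> (if k = 0 then 3 else 4 * k)" by simp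
  ultimately have "is_kernel (result ?c s)"
    using yes[of "{..<n}"] yes[of "{..<0}"] True unfolding is_kernel_def by blast
  then have "reach ?c s (cost ?c) is_kernel" by (intro reach_loop_free) simp_all
  moreover have "bval (Equal (Var vM) (Num 0)) s" using v by simp
  ultimately have "reach kernel s (bcost (Equal (Var vM) (Num 0)) + cost ?c + 1) is_kernel"
    unfolding kernel_def by (intro reach_If) simp_all
  then show ?thesis by (rule reach_mono) (simp_all add: time_factor_def)
next
  case False
  then have m: "1 \<le> card E" using finite_E by (simp add: Suc_le_eq card_gt_0_iff)
  \<comment> \<open>An edge provides a vertex, so both assumptions of \<open>bilinear_le\<close>
    hold in this case.\<close>
  obtain x y where "{x, y} \<in> E" using False graph unfolding simple_graph_def by blast
  then have n: "1 \<le> n" using simple_graph_edge(2)[OF graph] by fastforce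
  let ?d = "Seq count_crossing (Seq renumber
      (If small (Seq collect (Seq copy_edges set_counts)) no_instance))"
  let ?t = "edges_cost (card E) cross_step + 2 + (n * (cost number_step + 4) + 8 + (bcost small +
      (edges_cost (card E) collect_step + 2 + (card E * (cost copy_step + 4) + 6 + cost set_counts)
        + cost no_instance) + 1))"
  have "reach (Seq find_pieces ?d) s (n * (vertex_cost + 8) + 6 + ?t) is_kernel"
    by (intro reach_Seq reach_mono[OF reach_find_pieces[OF s] order_refl] reach_pieces_kernel) auto
  moreover have "\<not> bval (Equal (Var vM) (Num 0)) s" using s(1) m by (simp add: holds_input_def)
  ultimately have "reach kernel s (bcost (Equal (Var vM) (Num 0)) + (n * (vertex_cost + 8) + 6 + ?t) + 1) is_kernel"
    unfolding kernel_def by (intro reach_If) simp_all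
  also have "bcost (Equal (Var vM) (Num 0)) + (n * (vertex_cost + 8) + 6 + ?t) + 1 =
     n * (card E * (2 * cost mark_step + 2 * cost core_step + 2 * cost piece_step + cost classify_step + 134)
       + (cost number_step + 71))
     + card E * (cost cross_step + cost collect_step + cost copy_step + 32)
     + (bcost small + cost set_counts + cost no_instance + 41)"
    by (simp add: vertex_cost_def edges_cost_def neighbours_cost_def algebra_simps)
  finally show ?thesis
    unfolding time_factor_def by (rule reach_mono) (rule bilinear_le[OF n m])
qed

end

lemma kernel_correct:
  assumes "input_state s n E k"
  obtains t s' n' E' k' where "exec kernel s t s'" "t \<le> time_factor * (n * card E + 1)"
    "represents s' n' E' k'"
    "strong_triadic_closure {..<n} E k \<longleftrightarrow> strong_triadic_closure {..<n'} E' k'"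
    "k' \<le> k" "n' \<le> (if k = 0 then 3 else 4 * k)"
proof -
  interpret edge_list n E k "arrs s 0" "arrs s 1"
    using assms by unfold_locales (auto simp: input_state_def represents_def)
  have "arrs s a = (\<lambda>_. 0)" if "a > 1" for a
    using assms that by (auto simp: input_state_def)
  then have "arrs s aPiece = (\<lambda>_. 0)" "stamps_le 0 s" by (simp_all add: stamps_le_def)
  moreover have "vars s vN = n" "vars s vM = card E" "vars s vK = k"
    using assms by (simp_all add: input_state_def represents_def)
  then have "holds_input s" unfolding holds_input_def by simp
  ultimately show thesis using reach_kernel that unfolding reach_def is_kernel_def by blast
qed

theorem theorem1:
  "\<exists>(c :: com) (g :: nat \<Rightarrow> nat). stc_problem_kernel c g \<and> (\<forall>k\<ge>1. g k \<le> 4 * k) \<and>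
     (\<exists>C. runs_in_time c (\<lambda>n m. C * (n * m + 1)))"
proof (intro exI conjI)
  let ?g = "\<lambda>k. if k = 0 then 3 else 4 * k :: nat"
  show time: "runs_in_time kernel (\<lambda>n m. time_factor * (n * m + 1))"
    unfolding runs_in_time_def by (meson kernel_correct)
  \<comment> \<open>Turns the sharp bound into the polynomial form that
    \<open>stc_problem_kernel\<close> asks for, with exponent 2 and the same factor.\<close>
  have "n * m + 1 \<le> (n + m + 1) ^ 2" for n m :: nat
    by (simp add: power2_eq_square algebra_simps)
  then have "time_factor * (n * m + 1) \<le> time_factor * (n + m + 1) ^ 2" for n m
    by (rule mult_le_mono2)
  then have "runs_in_time kernel (\<lambda>n m. time_factor * (n + m + 1) ^ 2)"
    using time unfolding runs_in_time_def by (meson order_trans)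
  moreover have "\<exists>t s' n' E' k'. exec kernel s t s' \<and> represents s' n' E' k' \<and>
      (strong_triadic_closure {..<n} E k \<longleftrightarrow> strong_triadic_closure {..<n'} E' k') \<and>
      k' \<le> k \<and> n' \<le> ?g k" if "input_state s n E k" for s n E k
    using kernel_correct[OF that] by metis
  ultimately show "stc_problem_kernel kernel ?g"
    unfolding stc_problem_kernel_def by blast
  show "\<forall>k\<ge>1. ?g k \<le> 4 * k" by simp
qed

end
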